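(* In the setting described in the context, let $\pi$ and $\Pi$ be the filters, i.e. the processes satisfying $\pi_t(\varphi)=\mathbb E[\varphi(X_{t\wedge\cdot})\mid\mathcal Y_t]$ for every bounded measurable $\varphi\colon\mathcal D_E\to\mathbb R$ and $\Pi_t(f)=\mathbb E[f(\mathbf X_t)\mid\mathcal Y_t]$ for every bounded measurable $f\colon H\to\mathbb R$, $t\ge0$. Then, for any bounded and measurable function $\varphi\colon\mathcal D_E\to\mathbb R$, the function $f\colon H\to\mathbb R$ defined as $f:=\varphi\circ S$ is bounded and measurable and $$\Pi_t(f)=\pi_t(\varphi),\qquad\mathbb P\text{-a.s.},\ t\ge0.\qquad( * )$$ Vice versa, for any bounded and measurable function $f\colon H\to\mathbb R$, the function $\varphi\colon\mathcal D_E\to\mathbb R$ given by $\varphi:=f\circ S^{-1}$ is bounded and measurable and $( * )$ holds.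
   Context: $(E,d_E)$ is a complete separable metric space; $(Z,\mathcal Z)$ is a Lusin space; $(\Omega,\mathcal F,\mathbb P)$ is a probability space with a complete right-continuous filtration $\mathbb F=(\mathcal F_t)_{t\ge0}$. $\mathcal D_E$ is the set of $E$-valued càdlàg functions on $[0,+\infty)$ (Skorokhod topology, Borel $\sigma$-algebra); $\widetilde{\mathcal D}_E\subset\mathcal D_E$ is the subset of piecewise constant paths with no explosion in finite time (their discontinuity times tend to $+\infty$). $\mathcal P(\cdot)$ denotes the set of probability measures, $\int_a^b=\int_{(a,b]}$. For a càdlàg process $\eta$, $\eta_{t\wedge\cdot}$ is the stopped path $s\mapsto\eta_{t\wedge s}$, and $\eta_{t^-\wedge\cdot}$ is the path equal to $\eta_s$ for $s<t$ and to $\eta_{t^-}$ for $s\ge t$. Signal. $(T_k)_{k\ge1}$ are $\mathbb F$-stopping times with $T_k\le T_{k+1}$ and $T_k<T_{k+1}$ on $\{T_k<+\infty\}$; $\zeta_k$ ($k\ge0$) are $E$-valued and $\mathcal F_{T_k}$-measurable ($T_0:=0$). The signal is $X_t=\zeta_0\mathbf 1_{[0,T_1)}(t)+\sum_{k\ge1}\zeta_k\mathbf 1_{[T_k,T_{k+1})}(t)$, and $(T_k)_{k\ge1}$ is referred to as the sequence of jump times of $X$. Its counting measure is $m((0,t]\times A)=\sum_{k\ge1}\mathbf 1_{T_k\le t}\mathbf 1_{X_{T_k}\in A}$, with $\mathbb F$-dual predictable projection $\mu$. Observation. $W$ is a real $\mathbb F$-Brownian motion and $n$ an $\mathbb F$-adapted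 random counting measure on $(0,+\infty)\times Z$ with $\mathbb F$-dual predictable projection $\nu$. Let $D^m=\{(\omega,t):m(\omega;\{t\}\times E)=1\}$, $J^m=\{(\omega,t):\mu(\omega;\{t\}\times E)>0\}$, $D^n=\{(\omega,t):n(\omega;\{t\}\times Z)=1\}$, $J^n=\{(\omega,t):\nu(\omega;\{t\}\times Z)>0\}$, and $m^i=\mathbf 1_{D^m\setminus J^m}m$, $m^p=\mathbf 1_{J^m}m$, $n^i=\mathbf 1_{D^n\setminus J^n}n$, $n^p=\mathbf 1_{J^n}n$. With measurable functions $b\colon[0,+\infty)\times\mathcal D_E\times\mathbb R\to\mathbb R$, $\sigma\colon[0,+\infty)\times\mathbb R\to(0,+\infty)$, $K^i,K^p\colon[0,+\infty)\times\mathcal D_E\times\mathbb R\times E\to\mathbb R$, $G^i,G^p\colon[0,+\infty)\times\mathcal D_E\times\mathbb R\times Z\to\mathbb R$, the observed process $Y$ is the unique solution of $$dY_t=b(t,X_{t\wedge\cdot},Y_t)dt+\sigma(t,Y_t)dW_t+\sum_{a\in\{i,p\}}\Big(\int_E K^a(t,X_{t^-\wedge\cdot},Y_{t^-},e)\,m^a(dt\,de)+\int_Z G^a(t,X_{t^-\wedge\cdot},Y_{t^-},z)\,n^a(dt\,dz)\Big),\quad Y_0=y_0\in\mathbb R,$$ and $\mathbb Y=(\mathcal Y_t)_{t\ge0}$ is its completed, right-continuous natural filtration. It is assumed that $m$ and $n$ have no common jump times and that $$\mu((0,t]\times A)=\int_0^t\int_A Q^m(s,X_{s^-\wedge\cdot};de)\lambda^m(s,X_{s^-\wedge\cdot})ds+\int_0^t\int_A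 R^m(s,X_{s^-\wedge\cdot};de)dp^m_s,$$ $$\nu((0,t]\times B)=\int_0^t\int_B Q^n(s,X_{s^-\wedge\cdot},Y_{s^-};dz)\lambda^n(s,X_{s^-\wedge\cdot},Y_{s^-})ds+\int_0^t\int_B R^n(s,X_{s^-\wedge\cdot},Y_{s^-};dz)dp^n_s,$$ with probability transition kernels $Q^m,R^m\colon(0,+\infty)\times\mathcal D_E\to\mathcal P(E)$ and $Q^n,R^n\colon(0,+\infty)\times\mathcal D_E\times\mathbb R\to\mathcal P(Z)$, bounded nonnegative measurable functions $\lambda^m$ on $(0,+\infty)\times\mathcal D_E$ and $\lambda^n$ on $(0,+\infty)\times\mathcal D_E\times\mathbb R$, and $\mathbb Y$-predictable counting processes $p^m,p^n$ with $\mathbb E[p^m_t]<\infty$, $\mathbb E[p^n_t]<\infty$ for all $t\ge0$. History process. Fix $\delta\notin E$. $H$ is the set of all sequences $h=(e_0,t_1,e_1,t_2,e_2,\dots)$ with $e_0\in E$, $e_n\in E\cup\{\delta\}$, $t_n\in(0,+\infty]$ ($n\ge1$), such that for all $n\ge1$: $t_n\le t_{n+1}$; $t_n<+\infty\Rightarrow t_n<t_{n+1}$; $t_n=+\infty\Leftrightarrow e_n=\delta$. $N(h)=\sup\{n\ge1:t_n<+\infty\}$ ($0$ if the set is empty). $H$ has the Borel $\sigma$-algebra of the metric $d(h,h')=\sum_{n=0}^{N}2^{-(n+2)}[\rho(|t_n-t_n'|)+\rho(d_E(e_n,e_n'))]$ if $N(h)=N(h')=N$, $d(h,h')=1$ otherwise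 ($t_0=t_0'=0$, $\rho(x)=x/(1+x)$). With $\xi_0=(X_0,+\infty,\delta,+\infty,\delta,\dots)$ and $\xi_n=(X_0,T_1,X_{T_1},\dots,T_n,X_{T_n},+\infty,\delta,+\infty,\delta,\dots)$, the history process is $\mathbf X_t=\xi_0$ on $[0,T_1)$, $\mathbf X_t=\xi_n$ on $[T_n,T_{n+1})$, $n\ge1$. The map $S\colon H\to\widetilde{\mathcal D}_E$ is the bijective map, measurable together with $S^{-1}$, asserted by the paper to satisfy $X_{t\wedge\cdot}=S(\mathbf X_t)$ and $\mathbf X_t=S^{-1}(X_{t\wedge\cdot})$ $\mathbb P$-a.s. for $t\ge0$; it is constructed as follows. With $t_0=0$, $S(h)=\sum_{k=0}^{n-1}e_k\mathbf 1_{[t_k,t_{k+1})}+e_n\mathbf 1_{[t_n,+\infty)}$ if $n:=N(h)<\infty$, and $S(h)=\sum_{k\ge0}e_k\mathbf 1_{[t_k,t_{k+1})}$ if $N(h)=\infty$; and $S^{-1}(x)=(e_0,t_1,e_1,\dots)$ with $e_0=x(0)$, $t_n=\inf\{t>t_{n-1}:x(t)\ne x(t_{n-1})\}$ ($+\infty$ if the set is empty), $e_n=x(t_n)$ if $t_n<+\infty$ and $e_n=\delta$ if $t_n=+\infty$.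
   Formalization: S(h) is no path on [0,∞) for exploding h in H, so f is φ∘S on non-exploding histories and 0 elsewhere; φ is f∘S⁻¹ on piecewise constant paths and 0 elsewhere; T_1>0 and X is required to change value at every finite T_k, as its jump times. *)

theory Defs
  imports "HOL-Probability.Probability"
begin

definition borel_of_topology :: "'a topology \<Rightarrow> 'a measure" where
  "borel_of_topology X = sigma (topspace X) {U. openin X U}"

text \<open>A measurable space is Lusin if it is isomorphic to a Borel subset of a compact metrizable
  space. Every such space embeds in \<open>\<real>\<^sup>\<nat>\<close>, so Borel subsets of that space suffice.\<close>

definition lusin_space :: "'z measure \<Rightarrow> bool" where
  "lusin_space Z \<longleftrightarrow>
    (\<exists>B f g. B \<in> sets (borel :: (nat \<Rightarrow> real) measure) \<and>
      f \<in> Z \<rightarrow>\<^sub>M restrict_space borel B \<and> g \<in> restrict_space borel B \<rightarrow>\<^sub>M Z \<and>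
      (\<forall>z\<in>space Z. g (f z) = z) \<and> (\<forall>y\<in>B. f (g y) = y))"


section \<open>Path spaces\<close>

text \<open>A path on \<open>[0,\<infinity>)\<close> is a function of type \<open>real \<Rightarrow> 'a\<close> that is \<open>undefined\<close> at negative
  times, so that two paths are equal iff they agree on \<open>[0,\<infinity>)\<close>.\<close>

definition cadlag :: "(real \<Rightarrow> 'a::topological_space) set" where
  "cadlag = {x \<in> extensional {0..}.
     (\<forall>t\<ge>0. (x \<longlongrightarrow> x t) (at_right t)) \<and> (\<forall>t>0. \<exists>l. (x \<longlongrightarrow> l) (at_left t))}"

definition time_changes :: "(real \<Rightarrow> real) set" where
  "time_changes = {\<theta>. strict_mono_on {0..} \<theta> \<and> \<theta> ` {0..} = {0..}}"

text \<open>The sets \<open>skorokhod_nbhd x \<epsilon>\<close>, \<open>\<epsilon> > 0\<close>, form a base of the neighbourhood filter of \<open>x\<close> in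
  Skorokhod's J1 topology: \<open>x\<^sub>n\<close> is eventually in each of them iff there are time changes \<open>\<theta>\<^sub>n\<close> with
  \<open>sup\<^sub>s \<bar>\<theta>\<^sub>n s - s\<bar> \<longlonglongrightarrow> 0\<close> and \<open>x\<^sub>n \<circ> \<theta>\<^sub>n \<longlonglongrightarrow> x\<close> uniformly on every \<open>[0,N]\<close>.
  They need not be open themselves.\<close>

definition skorokhod_nbhd :: "(real \<Rightarrow> 'a::metric_space) \<Rightarrow> real \<Rightarrow> (real \<Rightarrow> 'a) set" where
  "skorokhod_nbhd x \<epsilon> = {y \<in> cadlag. \<exists>\<theta>\<in>time_changes.
     (\<forall>s\<ge>0. \<bar>\<theta> s - s\<bar> < \<epsilon>) \<and> (\<forall>s\<in>{0..1/\<epsilon>}. dist (y (\<theta> s)) (x s) < \<epsilon>)}"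

definition skorokhod_topology :: "(real \<Rightarrow> 'a::metric_space) topology" where
  "skorokhod_topology =
     topology (\<lambda>U. U \<subseteq> cadlag \<and> (\<forall>x\<in>U. \<exists>\<epsilon>>0. skorokhod_nbhd x \<epsilon> \<subseteq> U))"

lemma skorokhod_nbhd_mono:
  assumes "0 < \<epsilon>" "\<epsilon> \<le> \<epsilon>'" shows "skorokhod_nbhd x \<epsilon> \<subseteq> skorokhod_nbhd x \<epsilon>'"
proof
  fix y assume "y \<in> skorokhod_nbhd x \<epsilon>"
  then obtain l where l: "y \<in> cadlag" "l \<in> time_changes" "\<forall>s\<ge>0. \<bar>l s - s\<bar> < \<epsilon>"
    "\<forall>s\<in>{0..1/\<epsilon>}. dist (y (l s)) (x s) < \<epsilon>"
    unfolding skorokhod_nbhd_def by blast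
  have "1/\<epsilon>' \<le> 1/\<epsilon>" using assms by (simp add: frac_le)
  then have "\<bar>l s - s\<bar> < \<epsilon>'" if "s \<ge> 0" for s using l(3) that assms(2) by fastforce
  moreover have "dist (y (l s)) (x s) < \<epsilon>'" if "s \<in> {0..1/\<epsilon>'}" for s
  proof -
    have "s \<in> {0..1/\<epsilon>}" using that \<open>1/\<epsilon>' \<le> 1/\<epsilon>\<close> by auto
    then show ?thesis using l(4) assms(2) by fastforce
  qed
  ultimately show "y \<in> skorokhod_nbhd x \<epsilon>'" unfolding skorokhod_nbhd_def using l(1,2) by blast
qed

lemma openin_skorokhod_topology:
  "openin skorokhod_topology U \<longleftrightarrow>
     U \<subseteq> cadlag \<and> (\<forall>x\<in>U. \<exists>\<epsilon>>0. skorokhod_nbhd x \<epsilon> \<subseteq> U)"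
proof -
  let ?P = "\<lambda>U :: (real \<Rightarrow> 'a) set. U \<subseteq> cadlag \<and> (\<forall>x\<in>U. \<exists>\<epsilon>>0. skorokhod_nbhd x \<epsilon> \<subseteq> U)"
  have "istopology ?P"
    unfolding istopology_def
  proof (intro conjI allI impI)
    fix S T :: "(real \<Rightarrow> 'a) set" assume S: "?P S" and T: "?P T"
    show "S \<inter> T \<subseteq> cadlag" using S by blast
    show "\<forall>x\<in>S \<inter> T. \<exists>\<epsilon>>0. skorokhod_nbhd x \<epsilon> \<subseteq> S \<inter> T"
    proof
      fix x assume x: "x \<in> S \<inter> T"
      obtain a where a: "a > 0" "skorokhod_nbhd x a \<subseteq> S" using S x by blast
      obtain b where b: "b > 0" "skorokhod_nbhd x b \<subseteq> T" using T x by blast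
      have "skorokhod_nbhd x (min a b) \<subseteq> S \<inter> T"
        using skorokhod_nbhd_mono[of "min a b" a x] skorokhod_nbhd_mono[of "min a b" b x] a b
        by auto
      then show "\<exists>\<epsilon>>0. skorokhod_nbhd x \<epsilon> \<subseteq> S \<inter> T" using a b by (intro exI[of _ "min a b"]) auto
    qed
  next
    fix K :: "(real \<Rightarrow> 'a) set set" assume K: "\<forall>S\<in>K. ?P S"
    show "\<Union>K \<subseteq> cadlag" using K by blast
    show "\<forall>x\<in>\<Union>K. \<exists>\<epsilon>>0. skorokhod_nbhd x \<epsilon> \<subseteq> \<Union>K" using K by (meson Union_iff Union_upper subset_trans)
  qed
  then show ?thesis unfolding skorokhod_topology_def by (simp add: topology_inverse')
qed

lemma topspace_skorokhod_topology [simp]: "topspace skorokhod_topology = cadlag"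
proof
  show "cadlag \<subseteq> topspace skorokhod_topology"
    by (rule openin_subset) (auto simp: openin_skorokhod_topology skorokhod_nbhd_def intro: exI[of _ 1])
  show "topspace skorokhod_topology \<subseteq> cadlag"
    unfolding topspace_def using openin_skorokhod_topology by blast
qed

abbreviation path_space :: "(real \<Rightarrow> 'a::metric_space) measure" where
  "path_space \<equiv> borel_of_topology skorokhod_topology"

definition discontinuities :: "(real \<Rightarrow> 'a::topological_space) \<Rightarrow> real set" where
  "discontinuities x = {t. 0 < t \<and> \<not> isCont x t}"

definition pure_jump_paths :: "(real \<Rightarrow> 'a::topological_space) set" where
  "pure_jump_paths = {x \<in> cadlag.
     (\<forall>T. finite (discontinuities x \<inter> {0..T})) \<and>
     (\<forall>s t. 0 \<le> s \<and> s \<le> t \<and> discontinuities x \<inter> {s<..t} = {} \<longrightarrow> x t = x s)}"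

definition stopped :: "real \<Rightarrow> (real \<Rightarrow> 'a) \<Rightarrow> real \<Rightarrow> 'a" where
  "stopped t x = (\<lambda>s\<in>{0..}. x (min t s))"

definition left_lim :: "(real \<Rightarrow> 'a::t2_space) \<Rightarrow> real \<Rightarrow> 'a" where
  "left_lim x t = Lim (at_left t) x"

definition pre_stopped :: "real \<Rightarrow> (real \<Rightarrow> 'a::t2_space) \<Rightarrow> real \<Rightarrow> 'a" where
  "pre_stopped t x = (\<lambda>s\<in>{0..}. if s < t then x s else left_lim x t)"

text \<open>\<open>step_path \<tau> z\<close> is the path \<open>\<Sum>k. z k \<cdot> 1\<^bsub>[\<tau> k, \<tau> (k + 1))\<^esub>\<close>. Its value is arbitrary at times not
  covered by these intervals, i.e. after an explosion of \<open>\<tau>\<close>.\<close>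

definition step_path :: "(nat \<Rightarrow> ennreal) \<Rightarrow> (nat \<Rightarrow> 'a) \<Rightarrow> real \<Rightarrow> 'a" where
  "step_path \<tau> z = (\<lambda>t\<in>{0..}. z (THE k. \<tau> k \<le> ennreal t \<and> ennreal t < \<tau> (Suc k)))"


section \<open>Histories\<close>

text \<open>The sequence \<open>(e\<^sub>0, t\<^sub>1, e\<^sub>1, t\<^sub>2, e\<^sub>2, \<dots>)\<close> is encoded as \<open>h n = (t\<^sub>n, e\<^sub>n)\<close> with \<open>t\<^sub>0 = 0\<close>;
  \<open>None\<close> is the cemetery point \<open>\<delta>\<close>.\<close>

type_synonym 'e hist = "nat \<Rightarrow> ennreal \<times> 'e option"

definition histories :: "'e hist set" where
  "histories = {h. fst (h 0) = 0 \<and> snd (h 0) \<noteq> None \<and>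
     (\<forall>n\<ge>1. 0 < fst (h n) \<and> fst (h n) \<le> fst (h (Suc n)) \<and>
       (fst (h n) < \<infinity> \<longrightarrow> fst (h n) < fst (h (Suc n))) \<and>
       (fst (h n) = \<infinity> \<longleftrightarrow> snd (h n) = None))}"

definition hist_length :: "'e hist \<Rightarrow> enat" where
  "hist_length h = (SUP n\<in>{n. 1 \<le> n \<and> fst (h n) < \<infinity>}. enat n)"

definition hist_dist :: "'e::metric_space hist \<Rightarrow> 'e hist \<Rightarrow> real" where
  "hist_dist h h' =
    (let \<rho> = (\<lambda>x::real. x / (1 + x)) in
     if hist_length h = hist_length h' then
       (\<Sum>n. if enat n \<le> hist_length h then
          (1/2)^(n + 2) * (\<rho> \<bar>enn2real (fst (h n)) - enn2real (fst (h' n))\<bar>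
            + \<rho> (dist (the (snd (h n))) (the (snd (h' n)))))
        else 0)
     else 1)"

lemma hist_length_less_top:
  assumes "h \<in> histories" "enat n \<le> hist_length h" shows "fst (h n) < \<infinity>"
proof (cases "n = 0")
  case False
  have mono: "fst (h i) \<le> fst (h j)" if "1 \<le> i" "i \<le> j" for i j
    using that(2,1)
  proof (induction rule: dec_induct)
    case (step m)
    then have "fst (h m) \<le> fst (h (Suc m))" using assms(1) unfolding histories_def by auto
    with step show ?case by auto
  qed simp
  show ?thesis
  proof (rule ccontr)
    assume "\<not> fst (h n) < \<infinity>"
    then have "fst (h m) = \<infinity>" if "n \<le> m" for m
      using mono[of n m] that False by (auto simp: top_unique top.not_eq_extremum[symmetric])
    then have "m \<le> n - 1" if "1 \<le> m" "fst (h m) < \<infinity>" for m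
      using that by (metis Suc_pred' False not_less_eq_eq not_le less_irrefl bot_nat_0.not_eq_extremum)
    then have "hist_length h \<le> enat (n - 1)"
      unfolding hist_length_def by (intro SUP_least) auto
    with assms(2) False show False by (auto dest: order_trans)
  qed
qed (use assms(1) in \<open>auto simp: histories_def\<close>)

lemma hist_length_less_imp:
  assumes "h \<in> histories" "hist_length h < enat n" shows "h n = (\<infinity>, None)"
proof -
  have n: "1 \<le> n" using assms(2) by (cases n) (auto simp: zero_enat_def[symmetric])
  have "fst (h n) = \<infinity>"
  proof (rule ccontr)
    assume "fst (h n) \<noteq> \<infinity>"
    then have "enat n \<le> hist_length h"
      unfolding hist_length_def using n by (intro SUP_upper) (auto simp: less_top)
    with assms(2) show False by simp
  qed
  moreover have "snd (h n) = None" using assms(1) n calculation unfolding histories_def by auto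
  ultimately show ?thesis by (simp add: prod_eq_iff)
qed

lemma Metric_space_hist_dist: "Metric_space (histories :: 'e::metric_space hist set) hist_dist"
proof -
  define \<rho> :: "real \<Rightarrow> real" where "\<rho> x = x / (1 + x)" for x
  define a :: "'e hist \<Rightarrow> 'e hist \<Rightarrow> nat \<Rightarrow> real" where
    "a h h' n = (if enat n \<le> hist_length h then
       (1/2)^(n + 2) * (\<rho> \<bar>enn2real (fst (h n)) - enn2real (fst (h' n))\<bar>
         + \<rho> (dist (the (snd (h n))) (the (snd (h' n))))) else 0)" for h h' n
  have d: "hist_dist h h' = (if hist_length h = hist_length h' then (\<Sum>n. a h h' n) else 1)"
    for h h' :: "'e hist"
    unfolding hist_dist_def a_def \<rho>_def by (simp add: Let_def)
  have \<rho>_bound: "0 \<le> \<rho> x" "\<rho> x \<le> 1" if "0 \<le> x" for x using that unfolding \<rho>_def by auto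
  have \<rho>_mono: "\<rho> x \<le> \<rho> y" if "0 \<le> x" "x \<le> y" for x y
    using that unfolding \<rho>_def by (simp add: field_simps)
  have \<rho>_add: "\<rho> (x + y) \<le> \<rho> x + \<rho> y" if "0 \<le> x" "0 \<le> y" for x y
  proof -
    have "\<rho> (x + y) = x / (1 + (x + y)) + y / (1 + (x + y))" unfolding \<rho>_def by (simp add: add_divide_distrib)
    also have "\<dots> \<le> \<rho> x + \<rho> y" unfolding \<rho>_def using that by (intro add_mono divide_left_mono) auto
    finally show ?thesis .
  qed
  have \<rho>_tri: "\<rho> z \<le> \<rho> x + \<rho> y" if "0 \<le> x" "0 \<le> y" "0 \<le> z" "z \<le> x + y" for x y z
    using \<rho>_mono[of z "x + y"] \<rho>_add[of x y] that by simp
  have a_nonneg: "0 \<le> a h h' n" for h h' n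
    unfolding a_def using \<rho>_bound by simp
  have a_le: "a h h' n \<le> (1/2) ^ (Suc n)" for h h' n
  proof -
    have "(1/2)^(n + 2) * (\<rho> \<bar>enn2real (fst (h n)) - enn2real (fst (h' n))\<bar>
         + \<rho> (dist (the (snd (h n))) (the (snd (h' n))))) \<le> (1/2)^(n + 2) * (1 + 1)"
      by (intro mult_left_mono add_mono \<rho>_bound) auto
    also have "\<dots> = (1/2) ^ Suc n" by simp
    finally show ?thesis unfolding a_def by simp
  qed
  have a_summable: "summable (a h h')" for h h'
    by (rule summable_comparison_test'[where g = "\<lambda>n. (1/2)^Suc n" and N = 0])
      (use a_nonneg a_le power_half_series in \<open>auto simp: sums_iff\<close>)
  have a_sum_le: "(\<Sum>n. a h h' n) \<le> 1" for h h'
    using suminf_le[OF a_le a_summable, of h h'] power_half_series by (auto simp: sums_iff)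
  have nonneg: "0 \<le> hist_dist h h'" for h h' :: "'e hist"
    unfolding d using suminf_nonneg[OF a_summable a_nonneg] by simp
  have le1: "hist_dist h h' \<le> 1" for h h' :: "'e hist"
    unfolding d using a_sum_le by simp
  have commute: "hist_dist h h' = hist_dist h' h" for h h' :: "'e hist"
  proof -
    have "a h h' = a h' h" if "hist_length h = hist_length h'"
      unfolding a_def using that by (auto simp: abs_minus_commute dist_commute)
    then show ?thesis unfolding d by auto
  qed
  have zero: "hist_dist h h' = 0 \<longleftrightarrow> h = h'" if h: "h \<in> histories" "h' \<in> histories" for h h' :: "'e hist"
  proof
    assume "hist_dist h h' = 0"
    then have N: "hist_length h = hist_length h'" and s: "(\<Sum>n. a h h' n) = 0"
      unfolding d by (auto split: if_splits)
    have a0: "a h h' n = 0" for n using suminf_eq_zero_iff[OF a_summable a_nonneg] s by blast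
    show "h = h'"
    proof
      fix n show "h n = h' n"
      proof (cases "enat n \<le> hist_length h")
        case True
        let ?x = "\<bar>enn2real (fst (h n)) - enn2real (fst (h' n))\<bar>"
        let ?y = "dist (the (snd (h n))) (the (snd (h' n)))"
        have "\<rho> ?x + \<rho> ?y = 0" using a0[of n] True unfolding a_def by simp
        then have "\<rho> ?x = 0" "\<rho> ?y = 0" using \<rho>_bound(1)[of ?x] \<rho>_bound(1)[of ?y] by auto
        moreover have "\<rho> u = 0 \<Longrightarrow> 0 \<le> u \<Longrightarrow> u = 0" for u unfolding \<rho>_def by (auto simp: divide_eq_0_iff)
        ultimately have eq: "?x = 0" "?y = 0" using abs_ge_zero zero_le_dist by blast+
        have fin: "fst (h n) < \<infinity>" "fst (h' n) < \<infinity>"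
          using hist_length_less_top h True N by metis+
        then have "fst (h n) = fst (h' n)"
          using eq(1) by (metis abs_eq_0 ennreal_enn2real eq_iff_diff_eq_0 infinity_ennreal_def)
        moreover have some: "g \<in> histories \<Longrightarrow> fst (g n) < \<infinity> \<Longrightarrow> snd (g n) \<noteq> None" for g :: "'e hist"
          unfolding histories_def by (cases n) auto
        have "snd (h n) = snd (h' n)"
          using some[OF h(1) fin(1)] some[OF h(2) fin(2)] eq(2) by auto
        ultimately show ?thesis by (simp add: prod_eq_iff)
      next
        case False
        then show ?thesis using hist_length_less_imp h N by (metis not_le)
      qed
    qed
  next
    assume "h = h'"
    then have "a h h' = (\<lambda>_. 0)" unfolding a_def \<rho>_def by auto
    then show "hist_dist h h' = 0" unfolding d using \<open>h = h'\<close> by simp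
  qed
  have tri: "hist_dist x z \<le> hist_dist x y + hist_dist y z" for x y z :: "'e hist"
  proof (cases "hist_length x = hist_length y \<and> hist_length y = hist_length z")
    case True
    have "a x z n \<le> a x y n + a y z n" for n
    proof -
      have "\<rho> \<bar>enn2real (fst (x n)) - enn2real (fst (z n))\<bar> \<le>
          \<rho> \<bar>enn2real (fst (x n)) - enn2real (fst (y n))\<bar> + \<rho> \<bar>enn2real (fst (y n)) - enn2real (fst (z n))\<bar>"
        by (rule \<rho>_tri) auto
      moreover have "\<rho> (dist (the (snd (x n))) (the (snd (z n)))) \<le>
          \<rho> (dist (the (snd (x n))) (the (snd (y n)))) + \<rho> (dist (the (snd (y n))) (the (snd (z n))))"
        by (rule \<rho>_tri) (auto intro: dist_triangle)
      ultimately show ?thesis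
        unfolding a_def using True by (simp flip: distrib_left)
    qed
    then have "(\<Sum>n. a x z n) \<le> (\<Sum>n. a x y n + a y z n)"
      by (intro suminf_le a_summable summable_add)
    also have "\<dots> = (\<Sum>n. a x y n) + (\<Sum>n. a y z n)"
      by (rule suminf_add[symmetric]) (rule a_summable)+
    finally show ?thesis unfolding d using True by simp
  next
    case False
    then have "hist_dist x y = 1 \<or> hist_dist y z = 1" unfolding d by auto
    then show ?thesis using le1[of x z] nonneg[of x y] nonneg[of y z] by auto
  qed
  show ?thesis by unfold_locales (rule nonneg commute zero tri | assumption)+
qed

abbreviation hist_space :: "'e::metric_space hist measure" where
  "hist_space \<equiv> borel_of_topology (Metric_space.mtopology histories hist_dist)"

text \<open>Membership in \<open>histories\<close> does not exclude \<open>N h = \<infinity>\<close> with bounded jump times; for such \<open>h\<close> the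
  formula for \<open>S\<close> does not give a path on \<open>[0,\<infinity>)\<close>.\<close>

definition nonexplosive_histories :: "'e hist set" where
  "nonexplosive_histories = {h \<in> histories. (\<lambda>n. fst (h n)) \<longlonglongrightarrow> \<infinity>}"

text \<open>The map \<open>S\<close>. If \<open>N h = n < \<infinity>\<close> then \<open>t\<^bsub>n+1\<^esub> = \<infinity>\<close>, so the last interval is \<open>[t\<^sub>n, \<infinity>)\<close>.\<close>

definition path_of_hist :: "'e hist \<Rightarrow> real \<Rightarrow> 'e" where
  "path_of_hist h = step_path (\<lambda>n. fst (h n)) (\<lambda>n. the (snd (h n)))"

primrec change_time :: "(real \<Rightarrow> 'e) \<Rightarrow> nat \<Rightarrow> ennreal" where
  "change_time x 0 = 0"
| "change_time x (Suc n) =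
     Inf (ennreal ` {t. change_time x n < ennreal t \<and> x t \<noteq> x (enn2real (change_time x n))})"

text \<open>The map \<open>S\<^sup>-\<^sup>1\<close>, meaningful on \<open>pure_jump_paths\<close>. There it is a right inverse of \<open>S\<close>; it is a
  two-sided inverse on the nonexplosive histories in which consecutive marks differ.\<close>

definition hist_of_path :: "(real \<Rightarrow> 'e) \<Rightarrow> 'e hist" where
  "hist_of_path x = (\<lambda>n. (change_time x n,
     if change_time x n < \<infinity> then Some (x (enn2real (change_time x n))) else None))"


section \<open>Filtrations and processes\<close>

text \<open>Filtrations are indexed by \<open>t \<ge> 0\<close>; for use with stopping times with values in \<open>[0,\<infinity>]\<close> they are
  extended to \<open>\<infinity>\<close>.\<close>

definition ext_filtration :: "'w measure \<Rightarrow> (real \<Rightarrow> 'w measure) \<Rightarrow> ennreal \<Rightarrow> 'w measure" where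
  "ext_filtration M F t = (if t = \<infinity> then M else F (enn2real t))"

definition usual_filtration :: "'w measure \<Rightarrow> (real \<Rightarrow> 'w measure) \<Rightarrow> bool" where
  "usual_filtration M F \<longleftrightarrow>
     filtration (space M) (ext_filtration M F) \<and>
     null_sets M \<subseteq> sets (F 0) \<and>
     (\<forall>t\<ge>0. sets (F t) = (\<Inter>u\<in>{t<..}. sets (F u)))"

definition completed_natural_filtration ::
    "'w measure \<Rightarrow> (real \<Rightarrow> 'w \<Rightarrow> real) \<Rightarrow> real \<Rightarrow> 'w measure" where
  "completed_natural_filtration M Y t = sigma (space M)
     (\<Inter>u\<in>{t<..}. sigma_sets (space M)
        ({Y s -` B \<inter> space M | s B. s \<in> {0..u} \<and> B \<in> sets borel} \<union> null_sets M))"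

definition predictable_sigma :: "'w measure \<Rightarrow> (real \<Rightarrow> 'w measure) \<Rightarrow> ('w \<times> real) measure" where
  "predictable_sigma M F = sigma (space M \<times> {0..})
     ({A \<times> {0} | A. A \<in> sets (F 0)} \<union> {A \<times> {s<..t} | A s t. 0 \<le> s \<and> s \<le> t \<and> A \<in> sets (F s)})"

definition brownian_motion ::
    "'w measure \<Rightarrow> (real \<Rightarrow> 'w measure) \<Rightarrow> (real \<Rightarrow> 'w \<Rightarrow> real) \<Rightarrow> bool" where
  "brownian_motion M F W \<longleftrightarrow>
     (\<forall>t\<ge>0. W t \<in> borel_measurable (F t)) \<and>
     (AE \<omega> in M. W 0 \<omega> = 0) \<and>
     (AE \<omega> in M. continuous_on {0..} (\<lambda>t. W t \<omega>)) \<and>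
     (\<forall>s t. 0 \<le> s \<and> s < t \<longrightarrow>
        distributed M lborel (\<lambda>\<omega>. W t \<omega> - W s \<omega>) (normal_density 0 (sqrt (t - s))) \<and>
        prob_space.indep_set M (sets (F s))
          {(\<lambda>\<omega>. W t \<omega> - W s \<omega>) -` B \<inter> space M | B. B \<in> sets borel})"

definition counting_process :: "'w measure \<Rightarrow> (real \<Rightarrow> 'w \<Rightarrow> nat) \<Rightarrow> bool" where
  "counting_process M p \<longleftrightarrow>
     (\<forall>\<omega>\<in>space M. p 0 \<omega> = 0 \<and> mono_on {0..} (\<lambda>t. p t \<omega>) \<and>
        (\<forall>t\<ge>0. \<forall>\<^sub>F s in at_right t. p s \<omega> = p t \<omega>) \<and>
        (\<forall>t>0. \<forall>\<^sub>F s in at_left t. p t \<omega> \<le> p s \<omega> + 1))"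

text \<open>The Lebesgue-Stieltjes measure \<open>dp\<close> of one path of a counting process.\<close>

definition stieltjes :: "(real \<Rightarrow> 'w \<Rightarrow> nat) \<Rightarrow> 'w \<Rightarrow> real measure" where
  "stieltjes p \<omega> = interval_measure (\<lambda>t. real (p (max 0 t) \<omega>))"

subsection \<open>The stochastic integral with respect to Brownian motion\<close>

definition simple_integrand ::
    "'w measure \<Rightarrow> (real \<Rightarrow> 'w measure) \<Rightarrow> nat \<Rightarrow> (nat \<Rightarrow> real) \<Rightarrow> (nat \<Rightarrow> 'w \<Rightarrow> real) \<Rightarrow> bool" where
  "simple_integrand M F N s \<xi> \<longleftrightarrow>
     0 \<le> s 0 \<and> (\<forall>i. s i \<le> s (Suc i)) \<and>
     (\<forall>i. \<xi> i \<in> borel_measurable (F (s i)) \<and> bounded (\<xi> i ` space M))"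

definition simple_process ::
    "nat \<Rightarrow> (nat \<Rightarrow> real) \<Rightarrow> (nat \<Rightarrow> 'w \<Rightarrow> real) \<Rightarrow> real \<Rightarrow> 'w \<Rightarrow> real" where
  "simple_process N s \<xi> t \<omega> = (\<Sum>i<N. \<xi> i \<omega> * indicator {s i<..s (Suc i)} t)"

definition simple_integral ::
    "(real \<Rightarrow> 'w \<Rightarrow> real) \<Rightarrow> nat \<Rightarrow> (nat \<Rightarrow> real) \<Rightarrow> (nat \<Rightarrow> 'w \<Rightarrow> real) \<Rightarrow> real \<Rightarrow> 'w \<Rightarrow> real" where
  "simple_integral W N s \<xi> t \<omega> =
     (\<Sum>i<N. \<xi> i \<omega> * (W (min t (s (Suc i))) \<omega> - W (min t (s i)) \<omega>))"

text \<open>\<open>ito_integral M F W H I\<close>: the process \<open>I\<close> is (a version of) \<open>\<integral>\<^sub>0\<^sup>t H\<^sub>s dW\<^sub>s\<close>, i.e. it is continuous,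
  adapted, and the limit in probability of the integrals of simple processes \<open>H\<^sup>k\<close> with
  \<open>\<integral>\<^sub>0\<^sup>t \<bar>H\<^sup>k\<^sub>s - H\<^sub>s\<bar>\<^sup>2 ds \<longlonglongrightarrow> 0\<close> in probability. Such \<open>H\<^sup>k\<close> exist iff
  \<open>\<integral>\<^sub>0\<^sup>t \<bar>H\<^sub>s\<bar>\<^sup>2 ds < \<infinity>\<close> almost surely for all \<open>t\<close>, and \<open>I\<close> is then unique up to indistinguishability.\<close>

definition ito_integral ::
    "'w measure \<Rightarrow> (real \<Rightarrow> 'w measure) \<Rightarrow> (real \<Rightarrow> 'w \<Rightarrow> real) \<Rightarrow> (real \<Rightarrow> 'w \<Rightarrow> real) \<Rightarrow>
     (real \<Rightarrow> 'w \<Rightarrow> real) \<Rightarrow> bool" where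
  "ito_integral M F W H I \<longleftrightarrow>
     (\<forall>t\<ge>0. (\<lambda>(\<omega>, s). H s \<omega>) \<in> borel_measurable (F t \<Otimes>\<^sub>M restrict_space borel {0..t})) \<and>
     (\<forall>t\<ge>0. I t \<in> borel_measurable (F t)) \<and>
     (AE \<omega> in M. continuous_on {0..} (\<lambda>t. I t \<omega>)) \<and>
     (\<exists>N s \<xi>. (\<forall>k. simple_integrand M F (N k) (s k) (\<xi> k)) \<and>
        (\<forall>t\<ge>0. \<forall>\<epsilon>>0.
           (\<lambda>k. measure M {\<omega>\<in>space M. ennreal \<epsilon> <
              (\<integral>\<^sup>+u\<in>{0..t}. ennreal ((simple_process (N k) (s k) (\<xi> k) u \<omega> - H u \<omega>)\<^sup>2) \<partial>lborel)})
             \<longlonglongrightarrow> 0 \<and>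
           (\<lambda>k. measure M {\<omega>\<in>space M. \<epsilon> < \<bar>simple_integral W (N k) (s k) (\<xi> k) t \<omega> - I t \<omega>\<bar>})
             \<longlonglongrightarrow> 0))"


section \<open>Random measures on \<open>(0,\<infinity>) \<times> Z\<close>\<close>

abbreviation mark_space :: "'z measure \<Rightarrow> (real \<times> 'z) measure" where
  "mark_space Z \<equiv> restrict_space borel {0<..} \<Otimes>\<^sub>M Z"

definition random_counting_measure ::
    "'w measure \<Rightarrow> (real \<Rightarrow> 'w measure) \<Rightarrow> 'z measure \<Rightarrow> ('w \<Rightarrow> (real \<times> 'z) measure) \<Rightarrow> bool" where
  "random_counting_measure M F Z n \<longleftrightarrow>
     (\<forall>\<omega>\<in>space M. sets (n \<omega>) = sets (mark_space Z) \<and>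
        (\<forall>A\<in>sets (mark_space Z). emeasure (n \<omega>) A \<in> insert \<infinity> (range of_nat)) \<and>
        (\<forall>t>0. emeasure (n \<omega>) ({t} \<times> space Z) \<le> 1)) \<and>
     (\<forall>t\<ge>0. \<forall>B\<in>sets Z. (\<lambda>\<omega>. emeasure (n \<omega>) ({0<..t} \<times> B)) \<in> borel_measurable (F t))"

definition dual_predictable_projection ::
    "'w measure \<Rightarrow> (real \<Rightarrow> 'w measure) \<Rightarrow> 'z measure \<Rightarrow>
     ('w \<Rightarrow> (real \<times> 'z) measure) \<Rightarrow> ('w \<Rightarrow> (real \<times> 'z) measure) \<Rightarrow> bool" where
  "dual_predictable_projection M F Z n \<nu> \<longleftrightarrow>
     (\<forall>\<omega>\<in>space M. sets (\<nu> \<omega>) = sets (mark_space Z)) \<and>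
     (\<forall>V :: ('w \<times> real) \<times> 'z \<Rightarrow> ennreal.
        V \<in> borel_measurable (predictable_sigma M F \<Otimes>\<^sub>M Z) \<longrightarrow>
          (\<lambda>(\<omega>, t). \<integral>\<^sup>+(s, z)\<in>{0<..t} \<times> space Z. V ((\<omega>, s), z) \<partial>\<nu> \<omega>)
            \<in> borel_measurable (predictable_sigma M F) \<and>
          (\<integral>\<^sup>+\<omega>. (\<integral>\<^sup>+(s, z). V ((\<omega>, s), z) \<partial>n \<omega>) \<partial>M) =
          (\<integral>\<^sup>+\<omega>. (\<integral>\<^sup>+(s, z). V ((\<omega>, s), z) \<partial>\<nu> \<omega>) \<partial>M))"

text \<open>The sets \<open>D\<close> and \<open>J\<close>, and the decomposition of a counting measure \<open>n\<close> with dual predictable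
  projection \<open>\<nu>\<close> into \<open>n\<^sup>i = 1\<^bsub>D - J\<^esub> n\<close> and \<open>n\<^sup>p = 1\<^sub>J n\<close>.\<close>

definition charged_once :: "'z measure \<Rightarrow> ('w \<Rightarrow> (real \<times> 'z) measure) \<Rightarrow> ('w \<times> real) set" where
  "charged_once Z n = {(\<omega>, t). 0 < t \<and> emeasure (n \<omega>) ({t} \<times> space Z) = 1}"

definition charged :: "'z measure \<Rightarrow> ('w \<Rightarrow> (real \<times> 'z) measure) \<Rightarrow> ('w \<times> real) set" where
  "charged Z \<nu> = {(\<omega>, t). 0 < t \<and> emeasure (\<nu> \<omega>) ({t} \<times> space Z) > 0}"

definition inaccessible_part ::
    "'z measure \<Rightarrow> ('w \<Rightarrow> (real \<times> 'z) measure) \<Rightarrow> ('w \<Rightarrow> (real \<times> 'z) measure) \<Rightarrow>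
     'w \<Rightarrow> (real \<times> 'z) measure" where
  "inaccessible_part Z n \<nu> \<omega> =
     density (n \<omega>) (\<lambda>(t, z). indicator (charged_once Z n - charged Z \<nu>) (\<omega>, t))"

definition predictable_part ::
    "'z measure \<Rightarrow> ('w \<Rightarrow> (real \<times> 'z) measure) \<Rightarrow> ('w \<Rightarrow> (real \<times> 'z) measure) \<Rightarrow>
     'w \<Rightarrow> (real \<times> 'z) measure" where
  "predictable_part Z n \<nu> \<omega> = density (n \<omega>) (\<lambda>(t, z). indicator (charged Z \<nu>) (\<omega>, t))"


section \<open>Signal, history process and observation\<close>

definition signal :: "(nat \<Rightarrow> 'w \<Rightarrow> ennreal) \<Rightarrow> (nat \<Rightarrow> 'w \<Rightarrow> 'e) \<Rightarrow> 'w \<Rightarrow> real \<Rightarrow> 'e" where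
  "signal T \<zeta> \<omega> = step_path (\<lambda>k. T k \<omega>) (\<lambda>k. \<zeta> k \<omega>)"

definition signal_measure ::
    "(nat \<Rightarrow> 'w \<Rightarrow> ennreal) \<Rightarrow> (nat \<Rightarrow> 'w \<Rightarrow> 'e::topological_space) \<Rightarrow> 'w \<Rightarrow> (real \<times> 'e) measure" where
  "signal_measure T \<zeta> \<omega> = distr (count_space {k. 1 \<le> k \<and> T k \<omega> < \<infinity>}) (mark_space borel)
     (\<lambda>k. (enn2real (T k \<omega>), signal T \<zeta> \<omega> (enn2real (T k \<omega>))))"

definition history_upto ::
    "(nat \<Rightarrow> 'w \<Rightarrow> ennreal) \<Rightarrow> (nat \<Rightarrow> 'w \<Rightarrow> 'e) \<Rightarrow> nat \<Rightarrow> 'w \<Rightarrow> 'e hist" where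
  "history_upto T \<zeta> n \<omega> = (\<lambda>k. if k \<le> n
     then (T k \<omega>, Some (signal T \<zeta> \<omega> (enn2real (T k \<omega>)))) else (\<infinity>, None))"

definition history_process ::
    "(nat \<Rightarrow> 'w \<Rightarrow> ennreal) \<Rightarrow> (nat \<Rightarrow> 'w \<Rightarrow> 'e) \<Rightarrow> real \<Rightarrow> 'w \<Rightarrow> 'e hist" where
  "history_process T \<zeta> t \<omega> =
     history_upto T \<zeta> (THE n. T n \<omega> \<le> ennreal t \<and> ennreal t < T (Suc n) \<omega>) \<omega>"

text \<open>\<open>observation_sde\<close> states that \<open>Y\<close> is a solution of the observation equation driven by the signal
  paths \<open>X\<close>, the Brownian motion \<open>W\<close> and the random measures \<open>mi mp ni np\<close>.\<close>

definition observation_sde ::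
    "'w measure \<Rightarrow> (real \<Rightarrow> 'w measure) \<Rightarrow> 'z measure \<Rightarrow> ('w \<Rightarrow> real \<Rightarrow> 'e::metric_space) \<Rightarrow>
     (real \<Rightarrow> 'w \<Rightarrow> real) \<Rightarrow>
     ('w \<Rightarrow> (real \<times> 'e) measure) \<Rightarrow> ('w \<Rightarrow> (real \<times> 'e) measure) \<Rightarrow>
     ('w \<Rightarrow> (real \<times> 'z) measure) \<Rightarrow> ('w \<Rightarrow> (real \<times> 'z) measure) \<Rightarrow>
     (real \<times> (real \<Rightarrow> 'e) \<times> real \<Rightarrow> real) \<Rightarrow> (real \<times> real \<Rightarrow> real) \<Rightarrow>
     (real \<times> (real \<Rightarrow> 'e) \<times> real \<times> 'e \<Rightarrow> real) \<Rightarrow> (real \<times> (real \<Rightarrow> 'e) \<times> real \<times> 'e \<Rightarrow> real) \<Rightarrow>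
     (real \<times> (real \<Rightarrow> 'e) \<times> real \<times> 'z \<Rightarrow> real) \<Rightarrow> (real \<times> (real \<Rightarrow> 'e) \<times> real \<times> 'z \<Rightarrow> real) \<Rightarrow>
     real \<Rightarrow> (real \<Rightarrow> 'w \<Rightarrow> real) \<Rightarrow> bool" where
  "observation_sde M F Z X W mi mp ni np b \<sigma> Ki Kp Gi Gp y\<^sub>0 Y \<longleftrightarrow>
     (\<forall>t\<ge>0. Y t \<in> borel_measurable (F t)) \<and>
     (\<forall>\<omega>\<in>space M. (\<lambda>t\<in>{0..}. Y t \<omega>) \<in> cadlag) \<and>
     (\<exists>I. ito_integral M F W (\<lambda>s \<omega>. \<sigma> (s, Y s \<omega>)) I \<and>
        (AE \<omega> in M. \<forall>t\<ge>0.
           let drift = (\<lambda>s. b (s, stopped s (X \<omega>), Y s \<omega>));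
               coeff_E = (\<lambda>K (s, e). K (s, pre_stopped s (X \<omega>), left_lim (\<lambda>u. Y u \<omega>) s, e));
               coeff_Z = (\<lambda>G (s, z). G (s, pre_stopped s (X \<omega>), left_lim (\<lambda>u. Y u \<omega>) s, z))
           in
             set_integrable lborel {0..t} drift \<and>
             set_integrable (mi \<omega>) ({0<..t} \<times> UNIV) (coeff_E Ki) \<and>
             set_integrable (mp \<omega>) ({0<..t} \<times> UNIV) (coeff_E Kp) \<and>
             set_integrable (ni \<omega>) ({0<..t} \<times> space Z) (coeff_Z Gi) \<and>
             set_integrable (np \<omega>) ({0<..t} \<times> space Z) (coeff_Z Gp) \<and>
             Y t \<omega> = y\<^sub>0 + set_lebesgue_integral lborel {0..t} drift + I t \<omega>
               + set_lebesgue_integral (mi \<omega>) ({0<..t} \<times> UNIV) (coeff_E Ki)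
               + set_lebesgue_integral (ni \<omega>) ({0<..t} \<times> space Z) (coeff_Z Gi)
               + set_lebesgue_integral (mp \<omega>) ({0<..t} \<times> UNIV) (coeff_E Kp)
               + set_lebesgue_integral (np \<omega>) ({0<..t} \<times> space Z) (coeff_Z Gp)))"

locale jump_filtering_model = prob_space M + complete_measure M
  for M :: "'w measure" +
  fixes F :: "real \<Rightarrow> 'w measure"
    and Z :: "'z measure"
    and T :: "nat \<Rightarrow> 'w \<Rightarrow> ennreal"
    and \<zeta> :: "nat \<Rightarrow> 'w \<Rightarrow> 'e::polish_space"
    and \<mu> :: "'w \<Rightarrow> (real \<times> 'e) measure"
    and W :: "real \<Rightarrow> 'w \<Rightarrow> real"
    and n \<nu> :: "'w \<Rightarrow> (real \<times> 'z) measure"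
    and b :: "real \<times> (real \<Rightarrow> 'e) \<times> real \<Rightarrow> real"
    and \<sigma> :: "real \<times> real \<Rightarrow> real"
    and Ki Kp :: "real \<times> (real \<Rightarrow> 'e) \<times> real \<times> 'e \<Rightarrow> real"
    and Gi Gp :: "real \<times> (real \<Rightarrow> 'e) \<times> real \<times> 'z \<Rightarrow> real"
    and y\<^sub>0 :: real
    and Y :: "real \<Rightarrow> 'w \<Rightarrow> real"
    and Qm Rm :: "real \<times> (real \<Rightarrow> 'e) \<Rightarrow> 'e measure"
    and lm :: "real \<times> (real \<Rightarrow> 'e) \<Rightarrow> real"
    and pm :: "real \<Rightarrow> 'w \<Rightarrow> nat"
    and Qn Rn :: "real \<times> (real \<Rightarrow> 'e) \<times> real \<Rightarrow> 'z measure"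
    and ln' :: "real \<times> (real \<Rightarrow> 'e) \<times> real \<Rightarrow> real"
    and pn :: "real \<Rightarrow> 'w \<Rightarrow> nat"
  assumes lusin: "lusin_space Z"
    and filtration: "usual_filtration M F"
    \<comment> \<open>the signal and its counting measure\<close>
    and T_0: "\<And>\<omega>. \<omega> \<in> space M \<Longrightarrow> T 0 \<omega> = 0"
    and T_stopping: "\<And>k. stopping_time (ext_filtration M F) (T k)"
    and T_mono: "\<And>k \<omega>. \<omega> \<in> space M \<Longrightarrow> T k \<omega> \<le> T (Suc k) \<omega>"
    and T_strict: "\<And>k \<omega>. \<omega> \<in> space M \<Longrightarrow> T k \<omega> < \<infinity> \<Longrightarrow> T k \<omega> < T (Suc k) \<omega>"
    and \<zeta>_measurable:
      "\<And>k. \<zeta> k \<in> borel_measurable (filtration.pre_sigma (space M) (ext_filtration M F) (T k))"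
    \<comment> \<open>the \<open>T k\<close> are jump times of the signal: the signal does change its value there\<close>
    and T_jump: "\<And>k \<omega>. \<omega> \<in> space M \<Longrightarrow> T (Suc k) \<omega> < \<infinity> \<Longrightarrow> \<zeta> (Suc k) \<omega> \<noteq> \<zeta> k \<omega>"
    and \<mu>: "dual_predictable_projection M F borel (signal_measure T \<zeta>) \<mu>"
    \<comment> \<open>the observation\<close>
    and W: "brownian_motion M F W"
    and n: "random_counting_measure M F Z n"
    and \<nu>: "dual_predictable_projection M F Z n \<nu>"
    and b_measurable:
      "b \<in> borel_measurable (restrict_space borel {0..} \<Otimes>\<^sub>M path_space \<Otimes>\<^sub>M borel)"
    and \<sigma>_measurable: "\<sigma> \<in> borel_measurable (restrict_space borel {0..} \<Otimes>\<^sub>M borel)"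
    and \<sigma>_pos: "\<And>t y. 0 \<le> t \<Longrightarrow> 0 < \<sigma> (t, y)"
    and K_measurable:
      "Ki \<in> borel_measurable (restrict_space borel {0..} \<Otimes>\<^sub>M path_space \<Otimes>\<^sub>M borel \<Otimes>\<^sub>M borel)"
      "Kp \<in> borel_measurable (restrict_space borel {0..} \<Otimes>\<^sub>M path_space \<Otimes>\<^sub>M borel \<Otimes>\<^sub>M borel)"
    and G_measurable:
      "Gi \<in> borel_measurable (restrict_space borel {0..} \<Otimes>\<^sub>M path_space \<Otimes>\<^sub>M borel \<Otimes>\<^sub>M Z)"
      "Gp \<in> borel_measurable (restrict_space borel {0..} \<Otimes>\<^sub>M path_space \<Otimes>\<^sub>M borel \<Otimes>\<^sub>M Z)"
    and Y_solution: "observation_sde M F Z (signal T \<zeta>) W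
        (inaccessible_part borel (signal_measure T \<zeta>) \<mu>) (predictable_part borel (signal_measure T \<zeta>) \<mu>)
        (inaccessible_part Z n \<nu>) (predictable_part Z n \<nu>) b \<sigma> Ki Kp Gi Gp y\<^sub>0 Y"
    and Y_unique: "\<And>Y'. observation_sde M F Z (signal T \<zeta>) W
        (inaccessible_part borel (signal_measure T \<zeta>) \<mu>) (predictable_part borel (signal_measure T \<zeta>) \<mu>)
        (inaccessible_part Z n \<nu>) (predictable_part Z n \<nu>) b \<sigma> Ki Kp Gi Gp y\<^sub>0 Y' \<Longrightarrow>
        AE \<omega> in M. \<forall>t\<ge>0. Y' t \<omega> = Y t \<omega>"
    and no_common_jumps: "AE \<omega> in M. \<forall>t>0.
        \<not> (emeasure (signal_measure T \<zeta> \<omega>) ({t} \<times> UNIV) > 0 \<and> emeasure (n \<omega>) ({t} \<times> space Z) > 0)"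
    \<comment> \<open>the form of the dual predictable projections\<close>
    and kernels_m:
      "Qm \<in> restrict_space borel {0<..} \<Otimes>\<^sub>M path_space \<rightarrow>\<^sub>M prob_algebra borel"
      "Rm \<in> restrict_space borel {0<..} \<Otimes>\<^sub>M path_space \<rightarrow>\<^sub>M prob_algebra borel"
    and lm: "lm \<in> borel_measurable (restrict_space borel {0<..} \<Otimes>\<^sub>M path_space)"
      "\<exists>C. \<forall>t>0. \<forall>x\<in>cadlag. 0 \<le> lm (t, x) \<and> lm (t, x) \<le> C"
    and kernels_n:
      "Qn \<in> restrict_space borel {0<..} \<Otimes>\<^sub>M path_space \<Otimes>\<^sub>M borel \<rightarrow>\<^sub>M prob_algebra Z"
      "Rn \<in> restrict_space borel {0<..} \<Otimes>\<^sub>M path_space \<Otimes>\<^sub>M borel \<rightarrow>\<^sub>M prob_algebra Z"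
    and ln': "ln' \<in> borel_measurable (restrict_space borel {0<..} \<Otimes>\<^sub>M path_space \<Otimes>\<^sub>M borel)"
      "\<exists>C. \<forall>t>0. \<forall>x\<in>cadlag. \<forall>y. 0 \<le> ln' (t, x, y) \<and> ln' (t, x, y) \<le> C"
    and pm: "counting_process M pm"
      "(\<lambda>(\<omega>, t). pm t \<omega>) \<in>
         predictable_sigma M (completed_natural_filtration M Y) \<rightarrow>\<^sub>M count_space UNIV"
      "\<And>t. 0 \<le> t \<Longrightarrow> integrable M (\<lambda>\<omega>. real (pm t \<omega>))"
    and pn: "counting_process M pn"
      "(\<lambda>(\<omega>, t). pn t \<omega>) \<in>
         predictable_sigma M (completed_natural_filtration M Y) \<rightarrow>\<^sub>M count_space UNIV"
      "\<And>t. 0 \<le> t \<Longrightarrow> integrable M (\<lambda>\<omega>. real (pn t \<omega>))"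
    and \<mu>_form: "AE \<omega> in M. \<forall>t\<ge>0. \<forall>A\<in>sets borel.
        let x = (\<lambda>s. pre_stopped s (signal T \<zeta> \<omega>)) in
        emeasure (\<mu> \<omega>) ({0<..t} \<times> A) =
          (\<integral>\<^sup>+s\<in>{0<..t}. emeasure (Qm (s, x s)) A * ennreal (lm (s, x s)) \<partial>lborel)
          + (\<integral>\<^sup>+s\<in>{0<..t}. emeasure (Rm (s, x s)) A \<partial>stieltjes pm \<omega>)"
    and \<nu>_form: "AE \<omega> in M. \<forall>t\<ge>0. \<forall>B\<in>sets Z.
        let x = (\<lambda>s. pre_stopped s (signal T \<zeta> \<omega>)); y = left_lim (\<lambda>u. Y u \<omega>) in
        emeasure (\<nu> \<omega>) ({0<..t} \<times> B) =
          (\<integral>\<^sup>+s\<in>{0<..t}. emeasure (Qn (s, x s, y s)) B * ennreal (ln' (s, x s, y s)) \<partial>lborel)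
          + (\<integral>\<^sup>+s\<in>{0<..t}. emeasure (Rn (s, x s, y s)) B \<partial>stieltjes pn \<omega>)"


section \<open>Filters\<close>

text \<open>\<open>filter_process M G S U \<pi>\<close>: the \<open>G\<close>-adapted process \<open>\<pi>\<close> with values in the probability
  measures on \<open>S\<close> is the filter of the \<open>S\<close>-valued process \<open>U\<close> given \<open>G\<close>.\<close>

definition filter_process ::
    "'w measure \<Rightarrow> (real \<Rightarrow> 'w measure) \<Rightarrow> 's measure \<Rightarrow> (real \<Rightarrow> 'w \<Rightarrow> 's) \<Rightarrow>
     (real \<Rightarrow> 'w \<Rightarrow> 's measure) \<Rightarrow> bool" where
  "filter_process M G S U \<pi> \<longleftrightarrow>
     (\<forall>t\<ge>0. \<pi> t \<in> G t \<rightarrow>\<^sub>M prob_algebra S \<and>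
        (\<forall>\<phi>\<in>borel_measurable S. bounded (\<phi> ` space S) \<longrightarrow>
           (AE \<omega> in M. (\<integral>x. \<phi> x \<partial>\<pi> t \<omega>) = real_cond_exp M (G t) (\<lambda>\<omega>. \<phi> (U t \<omega>)) \<omega>)))"

end

theory Submission
  imports Defs
begin

text \<open>The filters \<open>\<pi>\<close> and \<open>\<Pi>\<close> are conditional expectations of functions of the stopped signal
  \<open>X\<^bsub>t \<and> \<cdot>\<^esub>\<close> and of the history \<open>\<^bold>X\<^sub>t\<close>, given the same observations. Almost surely the signal does not
  explode. Then \<open>X\<^bsub>t \<and> \<cdot>\<^esub>\<close> is a pure jump path with finitely many jumps, \<open>\<^bold>X\<^sub>t\<close> lists these jumps, and
  \<open>S\<close> and \<open>S\<^sup>-\<^sup>1\<close> exchange the two (\<open>history_is_history_of_stopped_signal\<close>). So \<open>f (\<^bold>X\<^sub>t)\<close> and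
  \<open>\<phi> (X\<^bsub>t \<and> \<cdot>\<^esub>)\<close> agree almost surely, and so do their conditional expectations. Three points need work.

  Nonexplosion (\<open>nonexplosive\<close>) is a consequence of the form of the dual predictable projection. The
  set \<open>(0, t \<and> T\<^sub>k]\<close> is predictable, so the expected number of jumps in it is the expectation of its
  \<open>\<mu>\<close>-mass, which is at most \<open>C t + p\<^sup>m\<^sub>t\<close>, independently of \<open>k\<close>. If explosion before \<open>t\<close> had positive
  probability, the expected number of jumps would tend to infinity with \<open>k\<close>.

  The map \<open>S\<close> is measurable because it is continuous on the nonexplosive histories
  (\<open>path_of_hist_continuous\<close>): if finitely many jump times and marks move a little, a piecewise linear
  time change matches the old jump times with the new ones.

  The inverse map is not continuous, as small jumps may vanish in the limit. It is measurable
  (\<open>measurable_hist_of_path\<close>) because right continuity allows one to express every jump time and every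
  mark by countably many evaluations of the path, which are Borel for Skorokhod's topology
  (\<open>measurable_evaluation\<close>), and because a map into the space of histories is measurable as soon as
  its coordinates are (\<open>measurable_hist_spaceI\<close>).\<close>


section \<open>Step paths\<close>

text \<open>The times may accumulate at a finite limit. Explosion has to be allowed at first, since it is only
  excluded almost surely and at the end of an argument about the paths of the signal.\<close>

definition jump_sequence :: "(nat \<Rightarrow> ennreal) \<Rightarrow> bool" where
  "jump_sequence \<tau> \<longleftrightarrow>
     \<tau> 0 = 0 \<and> (\<forall>n. \<tau> n \<le> \<tau> (Suc n) \<and> (\<tau> n < \<infinity> \<longrightarrow> \<tau> n < \<tau> (Suc n)))"

lemma jump_sequence_mono:
  assumes "jump_sequence \<tau>" "i \<le> j" shows "\<tau> i \<le> \<tau> j"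
  using assms by (auto simp: jump_sequence_def intro: lift_Suc_mono_le)

lemma jump_sequence_less:
  assumes "jump_sequence \<tau>" "i < j" "\<tau> i < \<infinity>" shows "\<tau> i < \<tau> j"
proof -
  have "\<tau> i < \<tau> (Suc i)" using assms by (auto simp: jump_sequence_def)
  also have "\<dots> \<le> \<tau> j" using assms by (intro jump_sequence_mono) auto
  finally show ?thesis .
qed

lemma jump_sequence_interval_unique:
  assumes "jump_sequence \<tau>" "\<tau> i \<le> t" "t < \<tau> (Suc i)" "\<tau> j \<le> t" "t < \<tau> (Suc j)"
  shows "i = j"
proof (rule ccontr)
  assume "i \<noteq> j"
  then consider "Suc i \<le> j" | "Suc j \<le> i" by linarith
  then show False
    using jump_sequence_mono[OF assms(1)] assms(2-) by cases (meson leD order_trans)+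
qed

lemma jump_sequence_interval_exists:
  assumes "jump_sequence \<tau>" "t < \<tau> n"
  shows "\<exists>i<n. \<tau> i \<le> t \<and> t < \<tau> (Suc i)"
  using assms(2)
proof (induction n)
  case 0
  then show ?case using assms(1) by (auto simp: jump_sequence_def)
next
  case (Suc n)
  then show ?case by (cases "t < \<tau> n") (auto simp: not_less intro: less_SucI)
qed

lemma jump_sequence_incseq: "jump_sequence \<tau> \<Longrightarrow> incseq \<tau>"
  by (simp add: incseq_def jump_sequence_mono)

lemma nonexplosive_iff:
  fixes \<tau> :: "nat \<Rightarrow> ennreal"
  assumes "incseq \<tau>"
  shows "\<tau> \<longlonglongrightarrow> \<infinity> \<longleftrightarrow> (\<forall>K::nat. \<exists>n. of_nat K < \<tau> n)"
proof
  assume lim: "\<tau> \<longlonglongrightarrow> \<infinity>"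
  show "\<forall>K::nat. \<exists>n. of_nat K < \<tau> n"
  proof
    fix K :: nat
    have "\<forall>\<^sub>F n in sequentially. of_nat K < \<tau> n"
      by (rule order_tendstoD(1)[OF lim]) (simp add: of_nat_less_top)
    then show "\<exists>n. of_nat K < \<tau> n" by (auto simp: eventually_sequentially)
  qed
next
  assume *: "\<forall>K::nat. \<exists>n. of_nat K < \<tau> n"
  show "\<tau> \<longlonglongrightarrow> \<infinity>"
  proof (rule order_tendstoI)
    fix a :: ennreal assume "a < \<infinity>"
    then obtain K :: nat where "a < of_nat K" using ennreal_Ex_less_of_nat by auto
    with * obtain n where "a < \<tau> n" by (meson order.strict_trans)
    then have "a < \<tau> m" if "n \<le> m" for m
      using incseqD[OF assms that] by simp
    then show "\<forall>\<^sub>F n in sequentially. a < \<tau> n" by (auto simp: eventually_sequentially)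
  qed auto
qed

lemma nonexplosiveD:
  assumes "jump_sequence \<tau>" "\<tau> \<longlonglongrightarrow> \<infinity>"
  obtains n where "ennreal t < \<tau> n"
proof -
  have "\<forall>\<^sub>F n in sequentially. ennreal t < \<tau> n"
    by (rule order_tendstoD(1)[OF assms(2)]) simp
  then show ?thesis using that by (auto simp: eventually_sequentially)
qed

lemma step_path_eq:
  assumes "jump_sequence \<tau>" "0 \<le> t" "\<tau> k \<le> ennreal t" "ennreal t < \<tau> (Suc k)"
  shows "step_path \<tau> z t = z k"
proof -
  have "(THE k. \<tau> k \<le> ennreal t \<and> ennreal t < \<tau> (Suc k)) = k"
    using assms jump_sequence_interval_unique[OF assms(1)] by (intro the_equality) blast+
  then show ?thesis unfolding step_path_def using assms(2) by simp
qed

lemma step_path_at_jump: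
  assumes "jump_sequence \<tau>" "\<tau> k < \<infinity>"
  shows "step_path \<tau> z (enn2real (\<tau> k)) = z k"
  by (rule step_path_eq) (use assms in \<open>auto simp: jump_sequence_def\<close>)

text \<open>\<open>truncate i \<tau>\<close> keeps the first \<open>i\<close> jump times. Stopping a step path amounts to truncating its
  jump times, also when the untruncated sequence explodes.\<close>

definition truncate :: "nat \<Rightarrow> (nat \<Rightarrow> ennreal) \<Rightarrow> nat \<Rightarrow> ennreal" where
  "truncate i \<tau> = (\<lambda>j. if j \<le> i then \<tau> j else \<infinity>)"

lemma jump_sequence_truncate:
  assumes "jump_sequence \<tau>" shows "jump_sequence (truncate i \<tau>)"
  using assms unfolding jump_sequence_def truncate_def by (auto simp: top.not_eq_extremum)

lemma truncate_tendsto: "truncate i \<tau> \<longlonglongrightarrow> \<infinity>"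
proof (rule tendsto_eventually)
  show "\<forall>\<^sub>F j in sequentially. truncate i \<tau> j = \<infinity>"
    using eventually_gt_at_top[of i] by eventually_elim (simp add: truncate_def)
qed

lemma step_path_truncate_before:
  assumes \<tau>: "jump_sequence \<tau>" and s: "0 \<le> s" "ennreal s < \<tau> (Suc i)"
  shows "step_path (truncate i \<tau>) z s = step_path \<tau> z s"
proof -
  obtain k where k: "k < Suc i" "\<tau> k \<le> ennreal s" "ennreal s < \<tau> (Suc k)"
    using jump_sequence_interval_exists[OF \<tau> s(2)] by blast
  have "step_path (truncate i \<tau>) z s = z k"
    by (rule step_path_eq[OF jump_sequence_truncate[OF \<tau>] s(1)])
      (use k in \<open>auto simp: truncate_def\<close>)
  then show ?thesis using step_path_eq[OF \<tau> s(1) k(2,3), of z] by simp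
qed

lemma step_path_truncate_after:
  assumes \<tau>: "jump_sequence \<tau>" and s: "0 \<le> s" "\<tau> i \<le> ennreal s"
  shows "step_path (truncate i \<tau>) z s = z i"
  by (rule step_path_eq[OF jump_sequence_truncate[OF \<tau>] s(1)])
    (use s in \<open>auto simp: truncate_def\<close>)

lemma stopped_step_path:
  assumes \<tau>: "jump_sequence \<tau>" and t: "0 \<le> t" "\<tau> i \<le> ennreal t" "ennreal t < \<tau> (Suc i)"
  shows "stopped t (step_path \<tau> z) = step_path (truncate i \<tau>) z"
proof
  fix s show "stopped t (step_path \<tau> z) s = step_path (truncate i \<tau>) z s"
  proof (cases "0 \<le> s")
    case True
    show ?thesis
    proof (cases "s \<le> t")
      case le: True
      then have "ennreal s < \<tau> (Suc i)" using t(3) ennreal_leI by (metis order_le_less_trans)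
      with step_path_truncate_before[OF \<tau> True this, of z] le True show ?thesis
        by (simp add: stopped_def min_def)
    next
      case False
      then have "\<tau> i \<le> ennreal s" using t(2) by (meson ennreal_leI linear order_trans)
      with step_path_truncate_after[OF \<tau> True this, of z] step_path_eq[OF \<tau> t, of z] False True
      show ?thesis by (simp add: stopped_def min_def)
    qed
  qed (simp add: stopped_def step_path_def)
qed

lemma ennreal_less_at_left:
  assumes "a < ennreal t" shows "\<forall>\<^sub>F s in at_left t. a < ennreal s"
proof -
  obtain a' where a: "a = ennreal a'" "0 \<le> a'" using assms by (cases a) auto
  then have "a' < t" using assms by (metis ennreal_less_iff)
  then show ?thesis
    using eventually_at_left[of a' t] a by (auto simp: ennreal_less_iff intro!: exI[of _ a'])
qed

lemma step_path_left_const: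
  assumes \<tau>: "jump_sequence \<tau>" and t: "\<tau> i < ennreal t" "ennreal t \<le> \<tau> (Suc i)"
  shows "\<forall>\<^sub>F s in at_left t. step_path \<tau> z s = z i"
proof -
  have t0: "0 < t" using t(1) by (metis ennreal_eq_0_iff linorder_not_le not_less_zero)
  have "\<forall>\<^sub>F s in at_left t. \<tau> i < ennreal s" by (rule ennreal_less_at_left[OF t(1)])
  moreover have "\<forall>\<^sub>F s in at_left t. s < t" by (simp add: eventually_at_filter)
  moreover have "\<forall>\<^sub>F s in at_left t. 0 < s" using t0 eventually_at_left by blast
  ultimately show ?thesis
  proof eventually_elim
    case (elim s)
    then have "ennreal s < ennreal t" by (simp add: ennreal_less_iff)
    then show ?case using elim t(2) by (intro step_path_eq[OF \<tau>]) auto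
  qed
qed

lemma pre_stopped_step_path:
  fixes z :: "nat \<Rightarrow> 'a::t2_space"
  assumes \<tau>: "jump_sequence \<tau>" and t: "\<tau> i < ennreal t" "ennreal t \<le> \<tau> (Suc i)"
  shows "pre_stopped t (step_path \<tau> z) = step_path (truncate i \<tau>) z"
proof
  have t0: "0 < t" using t(1) by (metis ennreal_eq_0_iff linorder_not_le not_less_zero)
  have left: "left_lim (step_path \<tau> z) t = z i"
    unfolding left_lim_def
    by (intro tendsto_Lim tendsto_eventually step_path_left_const[OF \<tau> t]) simp
  fix s show "pre_stopped t (step_path \<tau> z) s = step_path (truncate i \<tau>) z s"
  proof (cases "0 \<le> s")
    case True
    show ?thesis
    proof (cases "s < t")
      case lt: True
      then have "ennreal s < \<tau> (Suc i)" using t(2) True by (metis ennreal_less_iff order_less_le_trans)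
      with step_path_truncate_before[OF \<tau> True this, of z] lt True show ?thesis
        by (simp add: pre_stopped_def)
    next
      case False
      then have "\<tau> i \<le> ennreal s" using t(1) by (meson ennreal_leI linorder_not_less less_imp_le order_trans)
      with step_path_truncate_after[OF \<tau> True this, of z] left False True
      show ?thesis by (simp add: pre_stopped_def)
    qed
  qed (simp add: pre_stopped_def step_path_def)
qed

lemma step_path_cadlag:
  assumes \<tau>: "jump_sequence \<tau>" "\<tau> \<longlonglongrightarrow> \<infinity>"
  shows "step_path \<tau> z \<in> cadlag"
  unfolding cadlag_def
proof (intro CollectI conjI allI impI)
  show "step_path \<tau> z \<in> extensional {0..}" by (simp add: step_path_def)
next
  fix t :: real assume t: "0 \<le> t"
  obtain n where "ennreal t < \<tau> n" using nonexplosiveD[OF \<tau>] .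
  then obtain i where i: "\<tau> i \<le> ennreal t" "ennreal t < \<tau> (Suc i)"
    using jump_sequence_interval_exists[OF \<tau>(1)] by blast
  obtain u where u: "t < u" "ennreal u \<le> \<tau> (Suc i)"
  proof (cases "\<tau> (Suc i)")
    case (real r)
    then have "t < r" using i(2) t by (simp add: ennreal_less_iff)
    with real that show ?thesis by auto
  next
    case top then show ?thesis using that[of "t + 1"] by simp
  qed
  have "\<forall>\<^sub>F s in at_right t. t < s \<and> s < u" using u(1) eventually_at_right[of t u] by auto
  then have "\<forall>\<^sub>F s in at_right t. step_path \<tau> z s = step_path \<tau> z t"
  proof eventually_elim
    case (elim s)
    then have "\<tau> i \<le> ennreal s" "ennreal s < \<tau> (Suc i)"
      using i u t by (meson ennreal_leI less_imp_le order_trans, metis ennreal_less_iff less_imp_le order_less_le_trans order_trans)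
    then show ?case using step_path_eq[OF \<tau>(1)] i t elim by (metis less_imp_le order_trans)
  qed
  then show "(step_path \<tau> z \<longlongrightarrow> step_path \<tau> z t) (at_right t)" by (rule tendsto_eventually)
next
  fix t :: real assume t: "0 < t"
  obtain n where n: "ennreal t \<le> \<tau> n" using nonexplosiveD[OF \<tau>] less_imp_le by metis
  define m where "m = (LEAST n. ennreal t \<le> \<tau> n)"
  have m: "ennreal t \<le> \<tau> m" unfolding m_def by (rule LeastI[where P = "\<lambda>n. ennreal t \<le> \<tau> n", OF n])
  have "m \<noteq> 0" using m t \<tau>(1) by (cases "m = 0") (auto simp: jump_sequence_def)
  then obtain i where i: "m = Suc i" using not0_implies_Suc by blast
  have "\<not> ennreal t \<le> \<tau> i" unfolding m_def by (rule not_less_Least) (use i m_def in auto)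
  then have "\<forall>\<^sub>F s in at_left t. step_path \<tau> z s = z i"
    using m i by (intro step_path_left_const \<tau>) auto
  then show "\<exists>l. (step_path \<tau> z \<longlongrightarrow> l) (at_left t)" using tendsto_eventually by blast
qed


section \<open>Change times of a path\<close>

declare change_time.simps(2) [simp del]

lemma change_time_Suc_less_iff:
  "change_time x (Suc n) < u \<longleftrightarrow>
     (\<exists>t. change_time x n < ennreal t \<and> x t \<noteq> x (enn2real (change_time x n)) \<and> ennreal t < u)"
  by (auto simp: change_time.simps(2) Inf_less_iff)

lemma change_time_mono: "change_time x n \<le> change_time x (Suc n)"
  by (auto simp: change_time.simps(2) intro!: Inf_greatest)

lemma constant_until_change_time:
  assumes "0 \<le> t" "change_time x n \<le> ennreal t" "ennreal t < change_time x (Suc n)"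
  shows "x t = x (enn2real (change_time x n))"
proof (cases "change_time x n = ennreal t")
  case True then show ?thesis using assms(1) by simp
next
  case False
  then have "change_time x n < ennreal t" using assms(2) by simp
  with assms(3) show ?thesis
    using change_time_Suc_less_iff[of x n "change_time x (Suc n)"]
      Inf_lower[of "ennreal t" "ennreal ` {t. change_time x n < ennreal t \<and> x t \<noteq> x (enn2real (change_time x n))}"]
    by (auto simp: change_time.simps(2) not_less[symmetric])
qed

lemma change_time_step_path:
  assumes \<tau>: "jump_sequence \<tau>" and z: "\<And>n. \<tau> (Suc n) < \<infinity> \<Longrightarrow> z (Suc n) \<noteq> z n"
  shows "change_time (step_path \<tau> z) n = \<tau> n"
proof (induction n)
  case 0
  then show ?case using \<tau> by (simp add: jump_sequence_def)
next
  case (Suc n)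
  let ?x = "step_path \<tau> z"
  let ?S = "{t. \<tau> n < ennreal t \<and> ?x t \<noteq> ?x (enn2real (\<tau> n))}"
  have "Inf (ennreal ` ?S) = \<tau> (Suc n)"
  proof (rule antisym)
    show "Inf (ennreal ` ?S) \<le> \<tau> (Suc n)"
    proof (cases "\<tau> (Suc n) < \<infinity>")
      case True
      have fin: "\<tau> n < \<infinity>" using True jump_sequence_mono[OF \<tau>, of n "Suc n"] by auto
      have "enn2real (\<tau> (Suc n)) \<in> ?S"
        using z[OF True] step_path_at_jump[OF \<tau> fin, of z] step_path_at_jump[OF \<tau> True, of z] True
          jump_sequence_less[OF \<tau>, of n "Suc n"] fin by auto
      then have "Inf (ennreal ` ?S) \<le> ennreal (enn2real (\<tau> (Suc n)))" by (intro Inf_lower imageI)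
      with True show ?thesis by simp
    qed (simp add: not_less top_unique)
    show "\<tau> (Suc n) \<le> Inf (ennreal ` ?S)"
    proof (rule Inf_greatest, clarify, rule ccontr)
      fix t assume t: "\<tau> n < ennreal t" "?x t \<noteq> ?x (enn2real (\<tau> n))" "\<not> \<tau> (Suc n) \<le> ennreal t"
      then have "0 < t" by (metis ennreal_eq_0_iff linorder_not_le not_less_zero)
      moreover have fin: "\<tau> n < \<infinity>" using t(1) by (auto simp: less_top intro: order.strict_trans)
      ultimately show False
        using step_path_eq[OF \<tau>, of t n z] step_path_at_jump[OF \<tau> fin, of z] t by auto
    qed
  qed
  with Suc show ?case by (simp add: change_time.simps(2))
qed

text \<open>The marks must change at each finite jump time: a jump time at which the path keeps its value cannot
  be recovered from the path.\<close>

lemma hist_of_step_path: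
  assumes \<tau>: "jump_sequence \<tau>" and z: "\<And>n. \<tau> (Suc n) < \<infinity> \<Longrightarrow> z (Suc n) \<noteq> z n"
  shows "hist_of_path (step_path \<tau> z) = (\<lambda>n. (\<tau> n, if \<tau> n < \<infinity> then Some (z n) else None))"
proof -
  have "change_time (step_path \<tau> z) n = \<tau> n" for n
    using change_time_step_path[of \<tau> z] \<tau> z by blast
  then show ?thesis using step_path_at_jump[OF \<tau>, of _ z] by (auto simp: hist_of_path_def fun_eq_iff)
qed

text \<open>By right continuity alone a path need not change its value at a change time, because the change
  may occur only immediately afterwards. In that case the next change time is the same, which the
  strict inequality excludes.\<close>

lemma value_changes_at_change_time:
  assumes fin: "change_time x (Suc n) < \<infinity>" and strict: "change_time x (Suc n) < change_time x (Suc (Suc n))"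
  shows "x (enn2real (change_time x (Suc n))) \<noteq> x (enn2real (change_time x n))"
proof
  assume eq: "x (enn2real (change_time x (Suc n))) = x (enn2real (change_time x n))"
  have "change_time x (Suc n) < change_time x (Suc (Suc n))" by fact
  then obtain t where t: "change_time x n < ennreal t" "x t \<noteq> x (enn2real (change_time x n))"
    "ennreal t < change_time x (Suc (Suc n))"
    unfolding change_time_Suc_less_iff[of x n] by blast
  have t0: "0 \<le> t" using t(1) by (metis ennreal_eq_0_iff linorder_not_le not_less_zero less_imp_le)
  show False
  proof (cases "ennreal t < change_time x (Suc n)")
    case True
    then show ?thesis using constant_until_change_time[OF t0, of x n] t by (simp add: less_imp_le)
  next
    case False
    then show ?thesis using constant_until_change_time[OF t0, of x "Suc n"] t eq by (simp add: not_less)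
  qed
qed

lemma discontinuous_at_change_time:
  fixes x :: "real \<Rightarrow> 'a::t2_space"
  assumes fin: "change_time x (Suc n) < \<infinity>" and strict: "change_time x n < change_time x (Suc n)"
    and changes: "x (enn2real (change_time x (Suc n))) \<noteq> x (enn2real (change_time x n))"
  shows "enn2real (change_time x (Suc n)) \<in> discontinuities x"
proof -
  define t where "t = enn2real (change_time x (Suc n))"
  have t: "ennreal t = change_time x (Suc n)" unfolding t_def using fin by (simp add: less_top)
  have t0: "0 < t" using t strict by (metis ennreal_eq_0_iff linorder_not_le not_less_zero)
  have "\<not> isCont x t"
  proof
    assume "isCont x t"
    then have "(x \<longlongrightarrow> x t) (at_left t)"
      by (simp add: isCont_def filterlim_at_split)
    moreover have "\<forall>\<^sub>F s in at_left t. x s = x (enn2real (change_time x n))"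
    proof -
      have "\<forall>\<^sub>F s in at_left t. change_time x n < ennreal s"
        by (rule ennreal_less_at_left) (use t strict in simp)
      moreover have "\<forall>\<^sub>F s in at_left t. s < t" by (simp add: eventually_at_filter)
      moreover have "\<forall>\<^sub>F s in at_left t. 0 < s" using t0 eventually_at_left by blast
      ultimately show ?thesis
      proof eventually_elim
        case (elim s)
        then have "ennreal s < ennreal t" by (simp add: ennreal_less_iff)
        then show ?case using elim t by (intro constant_until_change_time) auto
      qed
    qed
    then have "(x \<longlongrightarrow> x (enn2real (change_time x n))) (at_left t)" by (rule tendsto_eventually)
    ultimately have "x t = x (enn2real (change_time x n))"
      by (rule tendsto_unique[rotated]) simp
    with changes show False unfolding t_def by simp
  qed
  with t0 show ?thesis unfolding discontinuities_def t_def by simp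
qed

text \<open>The recursion for the change times only looks at the current time. Hence once two consecutive
  change times agree, all later ones agree with them, and the sequence stays bounded.\<close>

lemma jump_sequence_change_time:
  assumes "change_time x \<longlonglongrightarrow> \<infinity>" shows "jump_sequence (change_time x)"
proof -
  have "change_time x n < change_time x (Suc n)" if fin: "change_time x n < \<infinity>" for n
  proof (rule ccontr)
    assume "\<not> ?thesis"
    then have eq: "change_time x (Suc n) = change_time x n"
      using change_time_mono[of x n] by auto
    have "change_time x (n + m) = change_time x n" for m
    proof (induction m)
      case (Suc m)
      then have "change_time x (Suc (n + m)) = change_time x (Suc n)" by (simp add: change_time.simps(2))
      with eq show ?case by simp
    qed simp
    then have "(\<lambda>m. change_time x (n + m)) \<longlonglongrightarrow> change_time x n" by simp
    moreover have "(\<lambda>m. change_time x (n + m)) \<longlonglongrightarrow> \<infinity>"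
      using LIMSEQ_ignore_initial_segment[OF assms, of n] by (simp add: add.commute)
    ultimately have "change_time x n = \<infinity>" by (rule LIMSEQ_unique)
    with fin show False by simp
  qed
  then show ?thesis by (simp add: jump_sequence_def change_time_mono)
qed

text \<open>If the change times stayed below some \<open>K\<close>, they would be infinitely many distinct discontinuities
  in \<open>[0,K]\<close>.\<close>

lemma change_time_tendsto_of_pure_jump:
  fixes x :: "real \<Rightarrow> 'a::t2_space"
  assumes x: "x \<in> pure_jump_paths" shows "change_time x \<longlonglongrightarrow> \<infinity>"
proof -
  have finite: "finite (discontinuities x \<inter> {0..T})" for T using x by (simp add: pure_jump_paths_def)
  have const: "x t = x s" if "0 \<le> s" "s \<le> t" "discontinuities x \<inter> {s<..t} = {}" for s t
    using x that unfolding pure_jump_paths_def by blast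
  have strict: "change_time x n < change_time x (Suc n)" if fin: "change_time x n < \<infinity>" for n
  proof -
    define s where "s = enn2real (change_time x n)"
    have s: "ennreal s = change_time x n" "0 \<le> s" using fin by (auto simp: s_def less_top)
    let ?D = "discontinuities x \<inter> {s<..s + 1}"
    have "finite ?D" by (rule finite_subset[OF _ finite[of "s + 1"]]) (use s(2) in auto)
    then obtain d where d: "s < d" "d \<le> s + 1" "\<And>u. u \<in> ?D \<Longrightarrow> d < u"
    proof (cases "?D = {}")
      case True then show ?thesis using that[of "s + 1"] by auto
    next
      case False
      define m where "m = Min ?D"
      have m: "s < m" "m \<le> s + 1" using False \<open>finite ?D\<close> Min_in[of ?D] by (auto simp: m_def)
      have "(s + m) / 2 < u" if "u \<in> ?D" for u
        using Min_le[OF \<open>finite ?D\<close> that] m(1) by (simp add: m_def[symmetric])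
      with m show ?thesis using that[of "(s + m) / 2"] by auto
    qed
    have eq: "x t = x s" if "s < t" "t \<le> d" for t
      using that d s(2) by (intro const) force+
    have "ennreal d \<le> change_time x (Suc n)"
    proof (rule ccontr)
      assume "\<not> ?thesis"
      then obtain t where "change_time x n < ennreal t" "x t \<noteq> x s" "ennreal t < ennreal d"
        unfolding not_le change_time_Suc_less_iff s_def by blast
      moreover from this s have "s < t" "t < d"
        by (metis ennreal_less_iff, metis ennreal_less_iff ennreal_leI leI leD)
      ultimately show False using eq by auto
    qed
    with d(1) s show ?thesis by (metis ennreal_less_iff order_less_le_trans)
  qed
  have js: "jump_sequence (change_time x)"
    by (simp add: jump_sequence_def change_time_mono strict)
  show ?thesis
    unfolding nonexplosive_iff[OF jump_sequence_incseq[OF js]]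
  proof (rule ccontr)
    assume "\<not> (\<forall>K::nat. \<exists>n. of_nat K < change_time x n)"
    then obtain K :: nat where K: "\<And>n. change_time x n \<le> of_nat K" by (auto simp: not_less)
    then have fin: "change_time x n < \<infinity>" for n
      by (metis infinity_ennreal_def of_nat_less_top order_le_less_trans)
    let ?r = "\<lambda>n. enn2real (change_time x (Suc n))"
    have "inj ?r"
    proof (rule injI, rule ccontr)
      fix i j assume ij: "?r i = ?r j" "i \<noteq> j"
      then have "change_time x (Suc i) = change_time x (Suc j)"
        using fin[of "Suc i"] fin[of "Suc j"] by (metis ennreal_enn2real infinity_ennreal_def)
      then show False
        using ij(2) jump_sequence_less[OF js _ fin] by (metis Suc_less_eq linorder_neqE_nat less_irrefl)
    qed
    moreover have "range ?r \<subseteq> discontinuities x \<inter> {0..real K}"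
    proof clarify
      fix n
      have "?r n \<le> real K" using K[of "Suc n"]
        by (metis enn2real_leI ennreal_of_nat_eq_real_of_nat of_nat_0_le_iff)
      moreover have "?r n \<in> discontinuities x"
        by (intro discontinuous_at_change_time value_changes_at_change_time fin strict)
      ultimately show "?r n \<in> discontinuities x \<inter> {0..real K}" by simp
    qed
    ultimately show False
      using finite[of "real K"] finite_subset finite_imageD by blast
  qed
qed

text \<open>Every discontinuity is a change time, and every finite change time but the first is a
  discontinuity. So discontinuities do not accumulate, and the path is constant between them.\<close>

lemma pure_jump_of_change_time_tendsto:
  fixes x :: "real \<Rightarrow> 'a::t2_space"
  assumes x: "x \<in> cadlag" and lim: "change_time x \<longlonglongrightarrow> \<infinity>" shows "x \<in> pure_jump_paths"
proof -
  let ?c = "change_time x"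
  have js: "jump_sequence ?c" by (rule jump_sequence_change_time[OF lim])
  have interval: "\<exists>k. ?c k \<le> ennreal t \<and> ennreal t < ?c (Suc k)" for t
    using nonexplosiveD[OF js lim, of t] jump_sequence_interval_exists[OF js] by metis
  have disc: "\<exists>k. t = enn2real (?c k)" if "t \<in> discontinuities x" for t
  proof (rule ccontr)
    assume not: "\<not> ?thesis"
    have t0: "0 < t" and "\<not> isCont x t" using that by (auto simp: discontinuities_def)
    obtain k where k: "?c k \<le> ennreal t" "ennreal t < ?c (Suc k)" using interval by blast
    then have less: "?c k < ennreal t" using not t0 by (metis enn2real_ennreal less_imp_le order_le_less)
    have "((\<lambda>s. ennreal s) \<longlongrightarrow> ennreal t) (nhds t)" by (intro tendsto_ennrealI filterlim_ident)
    then have "\<forall>\<^sub>F s in nhds t. ?c k < ennreal s \<and> ennreal s < ?c (Suc k)"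
      using less k(2) by (auto simp: order_tendsto_iff eventually_conj_iff)
    moreover have "\<forall>\<^sub>F s in nhds t. 0 < s" using t0 by (rule order_tendstoD(1)[OF filterlim_ident])
    ultimately have "\<forall>\<^sub>F s in nhds t. x s = x (enn2real (?c k))"
      by eventually_elim (auto intro!: constant_until_change_time)
    moreover from this have "x t = x (enn2real (?c k))" by (rule eventually_nhds_x_imp_x)
    ultimately have "\<forall>\<^sub>F s in nhds t. x s = x t" by simp
    then have "isCont x t"
      unfolding isCont_def by (intro tendsto_eventually) (auto simp: eventually_nhds_conv_at)
    with \<open>\<not> isCont x t\<close> show False by simp
  qed
  have "finite (discontinuities x \<inter> {0..T})" for T
  proof -
    obtain n where n: "ennreal T < ?c n" using nonexplosiveD[OF js lim] .
    have "discontinuities x \<inter> {0..T} \<subseteq> (\<lambda>k. enn2real (?c k)) ` {..n}"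
    proof
      fix t assume t: "t \<in> discontinuities x \<inter> {0..T}"
      obtain k where k: "?c k \<le> ennreal t" "ennreal t < ?c (Suc k)" using interval by blast
      from t disc obtain j where j: "t = enn2real (?c j)" by blast
      have "0 < t" using t by (auto simp: discontinuities_def)
      then have tj: "ennreal t = ?c j" using j by (metis enn2real_top ennreal_enn2real less_irrefl less_top)
      have "j \<le> n"
      proof (rule ccontr)
        assume "\<not> j \<le> n"
        then have "?c n \<le> ?c j" by (intro jump_sequence_mono[OF js]) simp
        then have "ennreal T < ennreal t" using n tj by simp
        then show False using t by (auto simp: ennreal_less_iff)
      qed
      then show "t \<in> (\<lambda>k. enn2real (?c k)) ` {..n}" using j by blast
    qed
    then show ?thesis by (rule finite_subset) simp
  qed
  moreover have "x t = x s" if st: "0 \<le> s" "s \<le> t" and none: "discontinuities x \<inter> {s<..t} = {}" for s t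
  proof -
    obtain k where k: "?c k \<le> ennreal s" "ennreal s < ?c (Suc k)" using interval by blast
    have "ennreal t < ?c (Suc k)"
    proof (rule ccontr)
      assume "\<not> ?thesis"
      then have le: "?c (Suc k) \<le> ennreal t" by simp
      then have fin: "?c (Suc k) < \<infinity>" by (auto simp: less_top[symmetric] top_unique)
      define r where "r = enn2real (?c (Suc k))"
      have r: "ennreal r = ?c (Suc k)" unfolding r_def using fin by simp
      have "?c k < \<infinity>" using k(1) by (auto simp: less_top[symmetric] top_unique)
      then have "?c k < ?c (Suc k)" by (intro jump_sequence_less[OF js]) auto
      moreover have "?c (Suc k) < ?c (Suc (Suc k))" using fin by (intro jump_sequence_less[OF js]) auto
      ultimately have "r \<in> discontinuities x"
        unfolding r_def by (intro discontinuous_at_change_time value_changes_at_change_time fin)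
      moreover have "s < r" using k(2) r st(1) by (metis ennreal_less_iff)
      moreover have "r \<le> t" using le r st by (metis ennreal_le_iff order_trans)
      ultimately show False using none by auto
    qed
    moreover have "?c k \<le> ennreal t" using k(1) st(2) by (meson ennreal_leI order_trans)
    ultimately have "x t = x (enn2real (?c k))" using st by (intro constant_until_change_time) auto
    also have "\<dots> = x s" using st k by (intro constant_until_change_time[symmetric]) auto
    finally show ?thesis .
  qed
  ultimately show ?thesis
    unfolding pure_jump_paths_def using x by (intro CollectI conjI allI impI) (assumption | blast)+
qed

text \<open>This description of the pure jump paths involves only the change times, whose measurability can
  be proved from the recursion that defines them.\<close>

lemma pure_jump_paths_eq:
  "(pure_jump_paths :: (real \<Rightarrow> 'a::t2_space) set) = {x \<in> cadlag. change_time x \<longlonglongrightarrow> \<infinity>}"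
proof (intro equalityI subsetI CollectI conjI)
  fix x :: "real \<Rightarrow> 'a" assume "x \<in> pure_jump_paths"
  then show "x \<in> cadlag" "change_time x \<longlonglongrightarrow> \<infinity>"
    by (simp add: pure_jump_paths_def, rule change_time_tendsto_of_pure_jump)
qed (blast intro: pure_jump_of_change_time_tendsto)


section \<open>Measurability of evaluations and change times\<close>

lemma space_borel_of_topology [simp]: "space (borel_of_topology X) = topspace X"
  unfolding borel_of_topology_def by (simp add: space_measure_of_conv)

lemma sets_borel_of_topology_open: "openin X U \<Longrightarrow> U \<in> sets (borel_of_topology X)"
  unfolding borel_of_topology_def by (subst sets_measure_of) (auto dest: openin_subset)

lemma measurable_borel_of_topologyI:
  assumes "\<And>x. x \<in> space N \<Longrightarrow> f x \<in> topspace X"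
    and "\<And>U. openin X U \<Longrightarrow> f -` U \<inter> space N \<in> sets N"
  shows "f \<in> N \<rightarrow>\<^sub>M borel_of_topology X"
  unfolding borel_of_topology_def
  by (rule measurable_measure_of) (use assms in \<open>auto dest: openin_subset\<close>)

lemma cadlag_right: "x \<in> cadlag \<Longrightarrow> 0 \<le> t \<Longrightarrow> (x \<longlongrightarrow> x t) (at_right t)"
  by (simp add: cadlag_def)

text \<open>A small time change moves a time in the open interval \<open>(a,b)\<close> to another time in \<open>(a,b)\<close>, so to
  take a value in an open set during \<open>(a,b)\<close> is stable under small perturbations of the path. These
  sets are the only open sets of paths from which measurability is derived below.\<close>

lemma openin_hits_open:
  fixes U :: "'a::metric_space set"
  assumes U: "open U" and a: "0 \<le> a"
  shows "openin skorokhod_topology {x \<in> cadlag. \<exists>s\<in>{a<..<b}. x s \<in> U}"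
  unfolding openin_skorokhod_topology
proof (intro conjI ballI)
  fix x assume "x \<in> {x \<in> cadlag. \<exists>s\<in>{a<..<b}. x s \<in> U}"
  then obtain s where s: "a < s" "s < b" "x s \<in> U" by auto
  obtain r where r: "0 < r" "ball (x s) r \<subseteq> U" using U s(3) openE by blast
  define \<epsilon> where "\<epsilon> = Min {r, s - a, b - s, 1 / s}"
  have \<epsilon>: "0 < \<epsilon>" "\<epsilon> \<le> r" "\<epsilon> \<le> s - a" "\<epsilon> \<le> b - s" "\<epsilon> \<le> 1 / s"
    unfolding \<epsilon>_def using r(1) s a by auto
  have "s \<le> 1 / \<epsilon>" using \<epsilon>(1,5) s(1) a by (simp add: field_simps)
  have "skorokhod_nbhd x \<epsilon> \<subseteq> {x \<in> cadlag. \<exists>s\<in>{a<..<b}. x s \<in> U}"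
  proof
    fix y assume "y \<in> skorokhod_nbhd x \<epsilon>"
    then obtain \<theta> where y: "y \<in> cadlag" "\<forall>s\<ge>0. \<bar>\<theta> s - s\<bar> < \<epsilon>"
      "\<forall>s\<in>{0..1/\<epsilon>}. dist (y (\<theta> s)) (x s) < \<epsilon>"
      unfolding skorokhod_nbhd_def by blast
    have "\<bar>\<theta> s - s\<bar> < \<epsilon>" using y(2) s(1) a by simp
    then have "\<theta> s \<in> {a<..<b}" using \<epsilon>(3,4) by auto
    moreover have "dist (y (\<theta> s)) (x s) < \<epsilon>" using y(3) s(1) a \<open>s \<le> 1 / \<epsilon>\<close> by simp
    then have "y (\<theta> s) \<in> U" using r(2) \<epsilon>(2) by (auto simp: subset_iff dist_commute)
    ultimately show "y \<in> {x \<in> cadlag. \<exists>s\<in>{a<..<b}. x s \<in> U}" using y(1) by blast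
  qed
  with \<epsilon>(1) show "\<exists>\<epsilon>>0. skorokhod_nbhd x \<epsilon> \<subseteq> {x \<in> cadlag. \<exists>s\<in>{a<..<b}. x s \<in> U}" by blast
qed auto

text \<open>Evaluation at a fixed time is not continuous in Skorokhod's topology. But by right continuity
  \<open>x t\<close> lies in an open set \<open>U\<close> iff immediately after \<open>t\<close> the path stays in the closure of some
  basic open set \<open>V\<close> with \<open>closure V \<subseteq> U\<close>, and staying there during an open interval is a closed
  condition on the path.\<close>

lemma measurable_evaluation:
  fixes t :: real
  assumes t: "0 \<le> t"
  shows "(\<lambda>x. x t) \<in> (path_space :: (real \<Rightarrow> 'e::polish_space) measure) \<rightarrow>\<^sub>M borel"
proof (rule borel_measurableI)
  fix U :: "'e set" assume U: "open U"
  obtain B :: "'e set set" where B: "countable B" "topological_basis B"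
    using ex_countable_basis by blast
  define B' where "B' = {V \<in> B. closure V \<subseteq> U}"
  let ?S = "\<lambda>V n. cadlag - {x \<in> cadlag. \<exists>s\<in>{t<..<t + 1 / real (Suc n)}. x s \<in> - closure V}"
  have "{x \<in> cadlag. x t \<in> U} = (\<Union>V\<in>B'. \<Union>n. ?S V n)"
  proof (intro equalityI subsetI)
    fix x assume x: "x \<in> {x \<in> cadlag. x t \<in> U}"
    then obtain r where r: "0 < r" "cball (x t) r \<subseteq> U" using U open_contains_cball by blast
    obtain V where V: "V \<in> B" "x t \<in> V" "V \<subseteq> ball (x t) r"
      using topological_basisE[OF B(2), of "ball (x t) r" "x t"] r(1) by auto
    have "closure V \<subseteq> cball (x t) r" using V(3) by (intro closure_minimal) auto
    with V r have "V \<in> B'" by (auto simp: B'_def)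
    have "open V" using topological_basis_open[OF B(2) V(1)] .
    then have "\<forall>\<^sub>F s in at_right t. x s \<in> V"
      using cadlag_right[of x t] x t V(2) by (auto simp: tendsto_def)
    then obtain b where b: "t < b" "\<forall>s>t. s < b \<longrightarrow> x s \<in> V"
      using eventually_at_right[of t "t + 1"] by auto
    then obtain n where n: "1 / real (Suc n) < b - t" using nat_approx_posE[of "b - t"] by auto
    have "x \<in> ?S V n" using x b(2) n closure_subset[of V] by auto
    with \<open>V \<in> B'\<close> show "x \<in> (\<Union>V\<in>B'. \<Union>n. ?S V n)" by blast
  next
    fix x assume "x \<in> (\<Union>V\<in>B'. \<Union>n. ?S V n)"
    then obtain V n where V: "V \<in> B'" and x: "x \<in> ?S V n" by blast
    have "\<forall>\<^sub>F s in at_right t. x s \<in> closure V"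
      using x by (intro eventually_at_rightI[of t "t + 1 / real (Suc n)"]) auto
    then have "x t \<in> closure V"
      using Lim_in_closed_set[OF closed_closure _ _ cadlag_right[of x t]] x t by auto
    with V x show "x \<in> {x \<in> cadlag. x t \<in> U}" by (auto simp: B'_def)
  qed
  also have "\<dots> \<in> sets path_space"
  proof -
    have S: "?S V n \<in> sets path_space" for V n
    proof (rule sets.Diff)
      show "cadlag \<in> sets path_space" using sets.top[of path_space] by simp
      show "{x \<in> cadlag. \<exists>s\<in>{t<..<t + 1 / real (Suc n)}. x s \<in> - closure V} \<in> sets path_space"
        by (rule sets_borel_of_topology_open[OF openin_hits_open[OF _ t]]) (simp add: open_Compl)
    qed
    have "countable B'" unfolding B'_def using B(1) by (rule countable_subset[rotated]) simp
    then show ?thesis by (intro sets.countable_UN'' S) simp_all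
  qed
  finally show "(\<lambda>x. x t) -` U \<inter> space path_space \<in> sets path_space"
    by (simp add: vimage_def Int_def conj_commute)
qed

text \<open>The random time is approximated strictly from above by times with values in a countable grid,
  along which the path converges by right continuity.\<close>

lemma measurable_value_at_random_time:
  fixes c :: "(real \<Rightarrow> 'e::polish_space) \<Rightarrow> real"
  assumes c: "c \<in> borel_measurable path_space" and c0: "\<And>x. 0 \<le> c x"
  shows "(\<lambda>x. x (c x)) \<in> path_space \<rightarrow>\<^sub>M borel"
proof -
  define r where "r m k = (real k + 1) / real (Suc m)" for m k
  define g where "g m x = nat \<lfloor>c x * real (Suc m)\<rfloor>" for m and x :: "real \<Rightarrow> 'e"
  have bounds: "c x < r m (g m x)" "r m (g m x) \<le> c x + 1 / real (Suc m)" for m x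
  proof -
    have "real (g m x) = of_int \<lfloor>c x * real (Suc m)\<rfloor>" unfolding g_def using c0[of x] by simp
    then have "c x * real (Suc m) < real (g m x) + 1" "real (g m x) \<le> c x * real (Suc m)"
      by linarith+
    moreover have "0 < real (Suc m)" by simp
    ultimately show "c x < r m (g m x)" "r m (g m x) \<le> c x + 1 / real (Suc m)"
      unfolding r_def
      by (simp_all only: pos_less_divide_eq pos_divide_le_eq distrib_right, simp)
  qed
  show ?thesis
  proof (rule borel_measurable_LIMSEQ_metric[where f = "\<lambda>m x. x (r m (g m x))"])
    fix m
    have "g m \<in> path_space \<rightarrow>\<^sub>M count_space UNIV" unfolding g_def using c by measurable
    moreover have "(\<lambda>x. x (r m k)) \<in> path_space \<rightarrow>\<^sub>M (borel :: 'e measure)" for k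
      by (rule measurable_evaluation) (simp add: r_def)
    ultimately show "(\<lambda>x. x (r m (g m x))) \<in> path_space \<rightarrow>\<^sub>M borel"
      by (intro measurable_compose_countable[where f = "\<lambda>k x. x (r m k)" and g = "g m"])
  next
    fix x :: "real \<Rightarrow> 'e" assume "x \<in> space path_space"
    then have "(x \<longlongrightarrow> x (c x)) (at_right (c x))" by (intro cadlag_right c0) simp
    moreover have "filterlim (\<lambda>m. r m (g m x)) (at_right (c x)) sequentially"
      unfolding filterlim_at
    proof
      have "(\<lambda>m. c x + 1 / real (Suc m)) \<longlonglongrightarrow> c x + 0"
        by (intro tendsto_add tendsto_const LIMSEQ_Suc[OF lim_1_over_n])
      then have "(\<lambda>m. c x + 1 / real (Suc m)) \<longlonglongrightarrow> c x" by (simp only: add_0_right)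
      then show "(\<lambda>m. r m (g m x)) \<longlonglongrightarrow> c x"
      proof (rule tendsto_sandwich[OF _ _ tendsto_const, rotated 2])
        show "\<forall>\<^sub>F m in sequentially. c x \<le> r m (g m x)"
          by (intro always_eventually allI less_imp_le bounds(1))
        show "\<forall>\<^sub>F m in sequentially. r m (g m x) \<le> c x + 1 / real (Suc m)"
          by (intro always_eventually allI bounds(2))
      qed
      show "\<forall>\<^sub>F m in sequentially. r m (g m x) \<in> {c x<..} \<and> r m (g m x) \<noteq> c x"
      proof (intro always_eventually allI)
        fix m show "r m (g m x) \<in> {c x<..} \<and> r m (g m x) \<noteq> c x" using bounds(1)[of x m] by simp
      qed
    qed
    ultimately show "(\<lambda>m. x (r m (g m x))) \<longlonglongrightarrow> x (c x)"
      by (rule filterlim_compose[where g = x])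
  qed
qed

text \<open>By right continuity a changed value persists for a short while, so it is seen at a rational time;
  this makes the union over times in the definition of the change time countable.\<close>

lemma change_time_Suc_less_iff_rat:
  fixes x :: "real \<Rightarrow> 'a::t1_space"
  assumes x: "x \<in> cadlag"
  shows "change_time x (Suc n) < u \<longleftrightarrow>
     (\<exists>q\<in>\<rat> \<inter> {0..}. change_time x n < ennreal q \<and> ennreal q < u \<and>
        x q \<noteq> x (enn2real (change_time x n)))" (is "_ \<longleftrightarrow> ?R")
proof
  let ?e = "x (enn2real (change_time x n))"
  assume "change_time x (Suc n) < u"
  then obtain t where t: "change_time x n < ennreal t" "x t \<noteq> ?e" "ennreal t < u"
    by (auto simp: change_time_Suc_less_iff)
  have t0: "0 \<le> t" using t(1) by (metis ennreal_eq_0_iff linorder_not_le not_less_zero less_imp_le)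
  have "\<forall>\<^sub>F s in at_right t. x s \<noteq> ?e"
    by (rule tendsto_imp_eventually_ne[OF cadlag_right[OF x t0] t(2)])
  moreover have "((\<lambda>s. ennreal s) \<longlongrightarrow> ennreal t) (at_right t)"
    by (intro tendsto_ennrealI tendsto_ident_at)
  then have "\<forall>\<^sub>F s in at_right t. ennreal s < u" using t(3) by (rule order_tendstoD(2))
  ultimately have "\<forall>\<^sub>F s in at_right t. x s \<noteq> ?e \<and> ennreal s < u" by eventually_elim simp
  then obtain b where b: "t < b" "\<And>s. t < s \<Longrightarrow> s < b \<Longrightarrow> x s \<noteq> ?e \<and> ennreal s < u"
    unfolding eventually_at_right_field by blast
  obtain q where q: "q \<in> \<rat>" "t < q" "q < b" using Rats_dense_in_real[OF b(1)] by blast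
  have "change_time x n < ennreal q" using t(1) q(2) by (meson ennreal_leI less_imp_le order_less_le_trans)
  then show ?R using b(2)[OF q(2,3)] q t0 by (intro bexI[of _ q]) auto
qed (auto simp: change_time_Suc_less_iff)

lemma measurable_change_time:
  "(\<lambda>x. change_time x n) \<in> (path_space :: (real \<Rightarrow> 'e::polish_space) measure) \<rightarrow>\<^sub>M borel"
proof (induction n)
  case (Suc n)
  note [measurable] = Suc
  have [measurable]: "(\<lambda>x. x (enn2real (change_time x n))) \<in> path_space \<rightarrow>\<^sub>M (borel :: 'e measure)"
    by (rule measurable_value_at_random_time) auto
  show ?case
  proof (rule borel_measurableI_less)
    fix u
    let ?A = "\<lambda>q. {x :: real \<Rightarrow> 'e. x \<in> space path_space \<and> change_time x n < ennreal q \<and> ennreal q < u \<and>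
        0 < dist (x q) (x (enn2real (change_time x n)))}"
    have "{x :: real \<Rightarrow> 'e. x \<in> space path_space \<and> change_time x (Suc n) < u} = (\<Union>q\<in>\<rat> \<inter> {0..}. ?A q)"
      by (auto simp: change_time_Suc_less_iff_rat)
    also have "\<dots> \<in> sets path_space"
    proof (rule sets.countable_UN'')
      fix q :: real assume "q \<in> \<rat> \<inter> {0..}"
      then have [measurable]: "(\<lambda>x. x q) \<in> path_space \<rightarrow>\<^sub>M (borel :: 'e measure)"
        by (intro measurable_evaluation) simp
      show "?A q \<in> sets path_space" by measurable
    qed (rule countable_Int1[OF countable_rat])
    finally show "{x :: real \<Rightarrow> 'e. x \<in> space path_space \<and> change_time x (Suc n) < u} \<in> sets path_space" .
  qed
qed simp


section \<open>The space of histories and the measurability of the inverse map\<close>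

text \<open>The summands of the series in \<open>hist_dist\<close>.\<close>

definition hist_dist_term :: "'e::metric_space hist \<Rightarrow> 'e hist \<Rightarrow> nat \<Rightarrow> real" where
  "hist_dist_term h h' n =
     (if enat n \<le> hist_length h then
        (1/2)^(n + 2) *
          (\<bar>enn2real (fst (h n)) - enn2real (fst (h' n))\<bar> / (1 + \<bar>enn2real (fst (h n)) - enn2real (fst (h' n))\<bar>)
            + dist (the (snd (h n))) (the (snd (h' n))) / (1 + dist (the (snd (h n))) (the (snd (h' n)))))
      else 0)"

lemma hist_dist_eq:
  "hist_dist h h' = (if hist_length h = hist_length h' then (\<Sum>n. hist_dist_term h h' n) else 1)"
  unfolding hist_dist_def hist_dist_term_def by (simp add: Let_def)

lemma hist_dist_term_nonneg: "0 \<le> hist_dist_term h h' n"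
  unfolding hist_dist_term_def by simp

lemma hist_dist_term_le: "hist_dist_term h h' n \<le> (1/2) ^ Suc n"
proof -
  have "x / (1 + x) \<le> 1" if "0 \<le> x" for x :: real using that by simp
  then have "x / (1 + x) + y / (1 + y) \<le> 2" if "0 \<le> x" "0 \<le> y" for x y :: real
    using add_mono[of "x / (1 + x)" 1 "y / (1 + y)" 1] that by simp
  then have "(1/2) ^ (n + 2) * (x / (1 + x) + y / (1 + y)) \<le> (1/2) ^ (n + 2) * 2"
    if "0 \<le> x" "0 \<le> y" for x y :: real
    using that by (intro mult_left_mono) auto
  then show ?thesis unfolding hist_dist_term_def by simp
qed

lemma summable_hist_dist_term: "summable (hist_dist_term h h')"
proof (rule summable_comparison_test')
  show "summable (\<lambda>n. (1/2::real) ^ Suc n)" using power_half_series by (simp add: sums_iff)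
  show "norm (hist_dist_term h h' n) \<le> (1/2) ^ Suc n" if "0 \<le> n" for n
    using hist_dist_term_le[of h h' n] hist_dist_term_nonneg[of h h' n] by simp
qed

text \<open>A single summand is at most the whole sum, and \<open>u \<mapsto> u / (1 + u)\<close> is strictly increasing. The bound
  is below \<open>1\<close>, the distance between histories of different lengths.\<close>

lemma hist_dist_less_imp_close:
  assumes \<eta>: "0 < \<eta>" and less: "hist_dist h h' < (1/2) ^ (m + 2) * (\<eta> / (1 + \<eta>))"
  shows "hist_length h = hist_length h'"
    and "n \<le> m \<Longrightarrow> enat n \<le> hist_length h \<Longrightarrow>
      \<bar>enn2real (fst (h n)) - enn2real (fst (h' n))\<bar> < \<eta> \<and> dist (the (snd (h n))) (the (snd (h' n))) < \<eta>"
proof -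
  have "(1/2) ^ (m + 2) * (\<eta> / (1 + \<eta>)) \<le> 1 * 1"
    using \<eta> by (intro mult_mono power_le_one) auto
  then show len: "hist_length h = hist_length h'"
    using less unfolding hist_dist_eq by (auto split: if_splits)
  assume n: "n \<le> m" "enat n \<le> hist_length h"
  define x y where "x = \<bar>enn2real (fst (h n)) - enn2real (fst (h' n))\<bar>"
    and "y = dist (the (snd (h n))) (the (snd (h' n)))"
  have xy: "0 \<le> x" "0 \<le> y" by (auto simp: x_def y_def)
  have "(1/2) ^ (n + 2) * (x / (1 + x) + y / (1 + y)) = hist_dist_term h h' n"
    using n by (simp add: hist_dist_term_def x_def y_def)
  also have "\<dots> \<le> (\<Sum>n. hist_dist_term h h' n)"
    using sum_le_suminf[OF summable_hist_dist_term, of "{n}" h h'] hist_dist_term_nonneg[of h h'] by simp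
  also have "\<dots> < (1/2) ^ (m + 2) * (\<eta> / (1 + \<eta>))" using less len by (simp add: hist_dist_eq)
  also have "\<dots> \<le> (1/2) ^ (n + 2) * (\<eta> / (1 + \<eta>))"
    using n \<eta> by (intro mult_right_mono power_decreasing) auto
  finally have "x / (1 + x) + y / (1 + y) < \<eta> / (1 + \<eta>)"
    by (rule mult_left_less_imp_less) simp
  moreover have "0 \<le> x / (1 + x)" "0 \<le> y / (1 + y)" using xy by auto
  ultimately have "x / (1 + x) < \<eta> / (1 + \<eta>)" "y / (1 + y) < \<eta> / (1 + \<eta>)" by auto
  then have "x < \<eta>" "y < \<eta>" using xy \<eta> by (auto simp: divide_simps algebra_simps)
  then show "\<bar>enn2real (fst (h n)) - enn2real (fst (h' n))\<bar> < \<eta> \<and> dist (the (snd (h n))) (the (snd (h' n))) < \<eta>"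
    by (simp add: x_def y_def)
qed

text \<open>The first \<open>m + 1\<close> summands are controlled by the coordinates, the others by a geometric series.\<close>

lemma hist_dist_le_if_close:
  assumes len: "hist_length h = hist_length h'"
    and close: "\<And>n. n \<le> m \<Longrightarrow> enat n \<le> hist_length h \<Longrightarrow>
      \<bar>enn2real (fst (h n)) - enn2real (fst (h' n))\<bar> \<le> \<eta> \<and> dist (the (snd (h n))) (the (snd (h' n))) \<le> \<eta>"
    and \<eta>: "0 \<le> \<eta>"
  shows "hist_dist h h' \<le> \<eta> + (1/2) ^ Suc m"
proof -
  have half: "summable (\<lambda>n. (1/2::real) ^ Suc n)" "(\<Sum>n. (1/2::real) ^ Suc n) = 1"
    using power_half_series by (auto simp: sums_iff)
  have head: "hist_dist_term h h' n \<le> \<eta> * (1/2) ^ Suc n" if "n \<le> m" for n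
  proof (cases "enat n \<le> hist_length h")
    case True
    define x y where "x = \<bar>enn2real (fst (h n)) - enn2real (fst (h' n))\<bar>"
      and "y = dist (the (snd (h n))) (the (snd (h' n)))"
    have xy: "0 \<le> x" "0 \<le> y" "x \<le> \<eta>" "y \<le> \<eta>" using close[OF that True] by (auto simp: x_def y_def)
    have le: "u / (1 + u) \<le> u" if "0 \<le> u" for u :: real
      using that by (simp add: divide_le_eq distrib_left)
    have "x / (1 + x) + y / (1 + y) \<le> 2 * \<eta>" using le[of x] le[of y] xy by simp
    then have "(1/2) ^ (n + 2) * (x / (1 + x) + y / (1 + y)) \<le> (1/2) ^ (n + 2) * (2 * \<eta>)"
      by (intro mult_left_mono) auto
    then show ?thesis using True by (simp add: hist_dist_term_def x_def y_def mult.commute)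
  qed (use \<eta> in \<open>simp add: hist_dist_term_def\<close>)
  have "(\<Sum>n<Suc m. hist_dist_term h h' n) \<le> (\<Sum>n<Suc m. \<eta> * (1/2) ^ Suc n)"
    by (intro sum_mono head) simp
  also have "\<dots> = \<eta> * (\<Sum>n<Suc m. (1/2) ^ Suc n)" by (rule sum_distrib_left[symmetric])
  also have "\<dots> \<le> \<eta> * 1"
    using sum_le_suminf[OF half(1), of "{..<Suc m}"] half(2) \<eta> by (intro mult_left_mono) auto
  finally have 1: "(\<Sum>n<Suc m. hist_dist_term h h' n) \<le> \<eta>" by simp
  have "(\<Sum>n. hist_dist_term h h' (n + Suc m)) \<le> (\<Sum>n. (1/2) ^ Suc m * (1/2) ^ Suc n)"
  proof (rule suminf_le)
    show "hist_dist_term h h' (n + Suc m) \<le> (1/2) ^ Suc m * (1/2) ^ Suc n" for n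
      using hist_dist_term_le[of h h' "n + Suc m"] by (simp add: power_add mult.commute)
    show "summable (\<lambda>n. hist_dist_term h h' (n + Suc m))"
      using summable_hist_dist_term[of h h'] by (subst summable_iff_shift)
    show "summable (\<lambda>n. (1/2::real) ^ Suc m * (1/2) ^ Suc n)" by (intro summable_mult half(1))
  qed
  also have "\<dots> = (1/2) ^ Suc m" using suminf_mult[OF half(1), of "(1/2) ^ Suc m"] half(2) by simp
  finally show ?thesis
    using 1 len suminf_split_initial_segment[OF summable_hist_dist_term, of h h' "Suc m"]
    by (simp add: hist_dist_eq)
qed

lemma hist_length_ge_iff:
  assumes "h \<in> histories" shows "enat n \<le> hist_length h \<longleftrightarrow> fst (h n) < \<infinity>"
proof
  assume fin: "fst (h n) < \<infinity>"
  show "enat n \<le> hist_length h"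
  proof (cases "n = 0")
    case False
    then show ?thesis unfolding hist_length_def using fin by (intro SUP_upper) auto
  qed (simp add: zero_enat_def[symmetric])
qed (rule hist_length_less_top[OF assms])

lemma enat_eq_iff_le: "N = N' \<longleftrightarrow> (\<forall>n. enat n \<le> N \<longleftrightarrow> enat n \<le> N')"
proof
  assume *: "\<forall>n. enat n \<le> N \<longleftrightarrow> enat n \<le> N'"
  have "a \<le> b" if le: "\<And>n. enat n \<le> a \<Longrightarrow> enat n \<le> b" for a b :: enat
  proof (cases a)
    case infinity
    show ?thesis
    proof (cases b)
      case (enat k)
      have "enat (Suc k) \<le> b" by (rule le) (simp add: infinity)
      with enat show ?thesis by simp
    qed simp
  next
    case (enat k)
    then show ?thesis using le[of k] by simp
  qed
  with * show "N = N'" by (intro antisym) blast+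
qed simp

lemma openin_hist_topology:
  "openin (Metric_space.mtopology histories hist_dist) U \<longleftrightarrow>
     U \<subseteq> histories \<and> (\<forall>h\<in>U. \<exists>r>0. \<forall>h'\<in>histories. hist_dist h h' < r \<longrightarrow> h' \<in> U)"
  unfolding Metric_space.openin_mtopology[OF Metric_space_hist_dist]
    Metric_space.mball_def[OF Metric_space_hist_dist] by blast

lemma topspace_hist_topology [simp]:
  "topspace (Metric_space.mtopology histories hist_dist) = histories"
  by (rule Metric_space.topspace_mtopology[OF Metric_space_hist_dist])

text \<open>The coordinates of a history as a point of a product of countably many separable metric spaces,
  with an arbitrary value after the last jump.\<close>

definition hist_coords :: "'e::metric_space hist \<Rightarrow> nat \<Rightarrow> real \<times> 'e" where
  "hist_coords h n = (if fst (h n) < \<infinity> then (enn2real (fst (h n)), the (snd (h n))) else (0, undefined))"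

text \<open>On histories of one fixed length the topology is that of coordinatewise convergence. The length has
  to be fixed, because it is locally constant for \<open>hist_dist\<close> but not for coordinatewise
  convergence.\<close>

lemma hist_topology_coords:
  fixes U :: "'e::metric_space hist set"
  assumes U: "openin (Metric_space.mtopology histories hist_dist) U"
  obtains V where "open V"
    "\<And>h. h \<in> histories \<Longrightarrow> hist_length h = N \<Longrightarrow> h \<in> U \<longleftrightarrow> hist_coords h \<in> V"
proof -
  define \<W> where "\<W> = {W. open W \<and> (\<forall>h\<in>histories. hist_length h = N \<and> hist_coords h \<in> W \<longrightarrow> h \<in> U)}"
  have "\<exists>W\<in>\<W>. hist_coords h \<in> W" if h: "h \<in> U" "hist_length h = N" for h
  proof -
    have hH: "h \<in> histories" using U h(1) by (auto simp: openin_hist_topology)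
    obtain r where r: "0 < r" "\<And>h'. h' \<in> histories \<Longrightarrow> hist_dist h h' < r \<Longrightarrow> h' \<in> U"
      using U h(1) unfolding openin_hist_topology by blast
    obtain m where m: "(1/2::real) ^ Suc m < r / 2"
    proof -
      obtain m where "(1/2::real) ^ m < r / 2" using real_arch_pow_inv[of "r / 2" "1/2"] r(1) by auto
      then have "(1/2::real) ^ Suc m < r / 2" using zero_less_power[of "1/2::real" m] unfolding power_Suc by linarith
      then show ?thesis by (rule that)
    qed
    define W where "W = (\<Inter>n\<le>m. {g. dist (g n) (hist_coords h n) < r / 2})"
    have "open {g :: nat \<Rightarrow> real \<times> 'e. dist (g n) c < r / 2}" for n c
      by (intro open_Collect_less continuous_intros continuous_on_product_coordinates)
    then have "open W" unfolding W_def by (intro open_INT) auto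
    moreover have "hist_coords h \<in> W" using r(1) by (simp add: W_def)
    moreover have "h' \<in> U" if h': "h' \<in> histories" "hist_length h' = N" "hist_coords h' \<in> W" for h'
    proof -
      have "hist_dist h h' \<le> r / 2 + (1/2) ^ Suc m"
      proof (rule hist_dist_le_if_close)
        show "hist_length h = hist_length h'" using h h' by simp
        fix n assume n: "n \<le> m" "enat n \<le> hist_length h"
        then have fin: "fst (h n) < \<infinity>" "fst (h' n) < \<infinity>"
          using hH h' h(2) hist_length_ge_iff by metis+
        have "dist (hist_coords h' n) (hist_coords h n) < r / 2" using h'(3) n(1) by (simp add: W_def)
        then show "\<bar>enn2real (fst (h n)) - enn2real (fst (h' n))\<bar> \<le> r / 2 \<and>
            dist (the (snd (h n))) (the (snd (h' n))) \<le> r / 2"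
          using dist_fst_le[of "hist_coords h' n" "hist_coords h n"]
            dist_snd_le[of "hist_coords h' n" "hist_coords h n"] fin
          by (auto simp: hist_coords_def dist_real_def dist_commute abs_minus_commute)
      qed (use r in simp)
      also have "\<dots> < r" using m by simp
      finally show ?thesis using r(2) h'(1) by blast
    qed
    ultimately show ?thesis unfolding \<W>_def by blast
  qed
  then have "h \<in> U \<longleftrightarrow> hist_coords h \<in> \<Union>\<W>" if "h \<in> histories" "hist_length h = N" for h
    using that unfolding \<W>_def by blast
  moreover have "open (\<Union>\<W>)" by (rule open_Union) (simp add: \<W>_def)
  ultimately show ?thesis using that by blast
qed

text \<open>There are only countably many lengths, and the product space of the coordinates is second
  countable, so that measurability can be checked one coordinate at a time.\<close>

lemma measurable_hist_spaceI:
  fixes f :: "'w \<Rightarrow> 'e::polish_space hist"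
  assumes H: "\<And>w. w \<in> space N \<Longrightarrow> f w \<in> histories"
    and t: "\<And>n. (\<lambda>w. fst (f w n)) \<in> borel_measurable N"
    and e: "\<And>n. e n \<in> borel_measurable N"
      "\<And>n w. w \<in> space N \<Longrightarrow> fst (f w n) < \<infinity> \<Longrightarrow> snd (f w n) = Some (e n w)"
  shows "f \<in> N \<rightarrow>\<^sub>M hist_space"
proof (rule measurable_borel_of_topologyI)
  fix U :: "'e hist set" assume U: "openin (Metric_space.mtopology histories hist_dist) U"
  note [measurable] = t e(1)
  have "\<exists>V. open V \<and> (\<forall>h\<in>histories. hist_length h = N \<longrightarrow> (h \<in> U \<longleftrightarrow> hist_coords h \<in> V))" for N
    using hist_topology_coords[OF U, of N] by metis
  then obtain V where V: "\<And>N. open (V N)"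
    "\<And>N h. h \<in> histories \<Longrightarrow> hist_length h = N \<Longrightarrow> h \<in> U \<longleftrightarrow> hist_coords h \<in> V N"
    by metis
  have coords: "(\<lambda>w. hist_coords (f w)) \<in> borel_measurable N"
  proof (rule measurable_coordinatewise_then_product)
    fix n
    have "(\<lambda>w. if fst (f w n) < \<infinity> then (enn2real (fst (f w n)), e n w) else (0, undefined))
        \<in> borel_measurable N" by measurable
    then show "(\<lambda>w. hist_coords (f w) n) \<in> borel_measurable N"
      by (subst measurable_cong[where g = "\<lambda>w. if fst (f w n) < \<infinity> then (enn2real (fst (f w n)), e n w) else (0, undefined)"])
        (auto simp: hist_coords_def e(2))
  qed
  have "f -` U \<inter> space N = (\<Union>L::enat. {w\<in>space N. (\<forall>n. enat n \<le> L \<longleftrightarrow> fst (f w n) < \<infinity>)} \<inter>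
      ((\<lambda>w. hist_coords (f w)) -` V L \<inter> space N))"
  proof -
    have L: "(\<forall>n. enat n \<le> L \<longleftrightarrow> fst (f w n) < \<infinity>) \<longleftrightarrow> hist_length (f w) = L" if "w \<in> space N" for w L
      unfolding enat_eq_iff_le[of "hist_length (f w)"] hist_length_ge_iff[OF H[OF that]] by blast
    have U: "f w \<in> U \<longleftrightarrow> hist_coords (f w) \<in> V (hist_length (f w))" if "w \<in> space N" for w
      by (rule V(2)[OF H[OF that] refl])
    show ?thesis
    proof (rule set_eqI)
      fix w show "w \<in> f -` U \<inter> space N \<longleftrightarrow> w \<in> (\<Union>L::enat. {w\<in>space N. (\<forall>n. enat n \<le> L \<longleftrightarrow> fst (f w n) < \<infinity>)} \<inter>
          ((\<lambda>w. hist_coords (f w)) -` V L \<inter> space N))"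
      proof (cases "w \<in> space N")
        case True
        show ?thesis
          unfolding Int_iff vimage_eq UN_iff mem_Collect_eq L[OF True] U[OF True] using True by simp
      qed simp
    qed
  qed
  also have "\<dots> \<in> sets N"
    using V(1) by (intro sets.countable_UN'' sets.Int[OF _ measurable_sets[OF coords]]) auto
  finally show "f -` U \<inter> space N \<in> sets N" .
qed (simp add: H)

lemma hist_of_path_histories:
  assumes lim: "change_time x \<longlonglongrightarrow> \<infinity>" shows "hist_of_path x \<in> histories"
proof -
  have js: "jump_sequence (change_time x)" by (rule jump_sequence_change_time[OF lim])
  have "0 < change_time x n" if "1 \<le> n" for n using jump_sequence_less[OF js, of 0 n] that by simp
  then show ?thesis
    unfolding histories_def hist_of_path_def
    using jump_sequence_mono[OF js] jump_sequence_less[OF js] by (auto simp: less_top[symmetric])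
qed

lemma sets_pure_jump_paths: "(pure_jump_paths :: (real \<Rightarrow> 'e::polish_space) set) \<in> sets path_space"
proof -
  note [measurable] = measurable_change_time
  have *: "change_time x \<longlonglongrightarrow> \<infinity> \<longleftrightarrow> (\<forall>K::nat. \<exists>n. of_nat K < change_time x n)"
    for x :: "real \<Rightarrow> 'e"
    by (intro nonexplosive_iff incseq_SucI change_time_mono)
  have "pure_jump_paths = {x \<in> space path_space. \<forall>K::nat. \<exists>n. of_nat K < change_time (x :: real \<Rightarrow> 'e) n}"
    unfolding pure_jump_paths_eq * by simp
  also have "\<dots> \<in> sets path_space" by measurable
  finally show ?thesis .
qed

lemma measurable_hist_of_path:
  "hist_of_path \<in> restrict_space path_space pure_jump_paths \<rightarrow>\<^sub>M (hist_space :: 'e::polish_space hist measure)"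
proof (rule measurable_hist_spaceI[where e = "\<lambda>n x. x (enn2real (change_time x n))"])
  show "hist_of_path x \<in> histories" if "x \<in> space (restrict_space path_space pure_jump_paths)" for x :: "real \<Rightarrow> 'e"
    using that by (intro hist_of_path_histories) (simp add: space_restrict_space pure_jump_paths_eq)
  show "(\<lambda>x. fst (hist_of_path x n)) \<in> borel_measurable (restrict_space path_space (pure_jump_paths :: (real \<Rightarrow> 'e) set))" for n
    unfolding hist_of_path_def fst_conv by (intro measurable_restrict_space1 measurable_change_time)
  show "(\<lambda>x. x (enn2real (change_time x n))) \<in> borel_measurable (restrict_space path_space (pure_jump_paths :: (real \<Rightarrow> 'e) set))" for n
    by (rule measurable_restrict_space1[OF measurable_value_at_random_time])
      (simp_all add: borel_measurable_enn2real[OF measurable_change_time])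
qed (simp add: hist_of_path_def)


section \<open>Continuity of the map from histories to paths\<close>

text \<open>The time change is piecewise linear, maps \<open>a k\<close> to \<open>b k\<close>, and is a translation after the last of
  these times. It is built by induction, inserting one linear piece at a time.\<close>

lemma time_change_exists:
  fixes a b :: "nat \<Rightarrow> real"
  assumes zero: "a 0 = 0" "b 0 = 0"
    and less: "\<And>k. k < m \<Longrightarrow> a k < a (Suc k) \<and> b k < b (Suc k)"
    and close: "\<And>k. k \<le> m \<Longrightarrow> \<bar>b k - a k\<bar> < \<epsilon>"
  shows "\<exists>\<theta>\<in>time_changes. (\<forall>k\<le>m. \<theta> (a k) = b k) \<and> (\<forall>s\<ge>0. \<bar>\<theta> s - s\<bar> < \<epsilon>) \<and>
    (\<forall>s\<ge>a m. \<theta> s = s + (b m - a m))"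
  using less close
proof (induction m)
  case 0
  have "(\<lambda>s. s) \<in> time_changes" by (auto simp: time_changes_def strict_mono_on_def)
  moreover have "0 < \<epsilon>" using "0.prems"(2)[of 0] by simp
  ultimately show ?case using zero by (intro bexI[of _ "\<lambda>s. s"]) auto
next
  case (Suc m)
  obtain \<theta> where \<theta>: "\<theta> \<in> time_changes" "\<And>k. k \<le> m \<Longrightarrow> \<theta> (a k) = b k"
    "\<And>s. 0 \<le> s \<Longrightarrow> \<bar>\<theta> s - s\<bar> < \<epsilon>"
    using Suc.IH Suc.prems by (metis le_SucI less_SucI)
  have mono: "\<theta> s < \<theta> t" if "0 \<le> s" "s < t" for s t
    using \<theta>(1) that by (auto simp: time_changes_def strict_mono_on_def)
  define A B A' B' where "A = a m" and "B = b m" and "A' = a (Suc m)" and "B' = b (Suc m)"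
  have less: "A < A'" "B < B'" using Suc.prems(1)[of m] by (auto simp: A_def B_def A'_def B'_def)
  note steps = Suc.prems(1)
  have "0 \<le> a k" if "k \<le> m" for k
    using that
  proof (induction k)
    case (Suc k)
    then show ?case using steps[of k] by simp
  qed (simp add: zero)
  then have A0: "0 \<le> A" by (simp add: A_def)
  have \<theta>A: "\<theta> A = B" using \<theta>(2)[of m] by (simp add: A_def B_def)
  have \<theta>0: "\<theta> 0 = 0" using \<theta>(2)[of 0] zero by simp
  define l where "l s = B + (s - A) * ((B' - B) / (A' - A))" for s
  have slope: "0 < (B' - B) / (A' - A)" using less by simp
  have l_mono: "l s < l t" if "s < t" for s t
    using mult_strict_right_mono[OF _ slope, of "s - A" "t - A"] that by (simp add: l_def)
  have lA: "l A = B" "l A' = B'" using less by (auto simp: l_def)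
  define \<theta>' where "\<theta>' s = (if s \<le> A then \<theta> s else if s \<le> A' then l s else s + (B' - A'))" for s
  have le_A: "\<theta>' s \<le> B" if "0 \<le> s" "s \<le> A" for s
    using mono[of s A] that \<theta>A by (cases "s = A") (auto simp: \<theta>'_def)
  have le_A': "\<theta>' s \<le> B'" if "0 \<le> s" "s \<le> A'" for s
    using le_A[of s] that less l_mono[of s A'] lA by (cases "s \<le> A"; cases "s = A'") (auto simp: \<theta>'_def)
  have \<theta>'_mono: "\<theta>' s < \<theta>' t" if st: "0 \<le> s" "s < t" for s t
  proof -
    consider "t \<le> A" | "A < t" "t \<le> A'" "s \<le> A" | "A < s" "t \<le> A'" | "A' < t" "s \<le> A'" | "A' < s"
      by linarith
    then show ?thesis
    proof cases
      case 1 then show ?thesis using mono st by (simp add: \<theta>'_def)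
    next
      case 2 then show ?thesis using le_A[OF st(1)] l_mono[of A t] lA by (simp add: \<theta>'_def)
    next
      case 3 then show ?thesis using l_mono[OF st(2)] st by (simp add: \<theta>'_def)
    next
      case 4 then show ?thesis using le_A'[OF st(1)] less by (simp add: \<theta>'_def)
    next
      case 5 then show ?thesis using st less by (simp add: \<theta>'_def)
    qed
  qed
  have "\<theta>' ` {0..} = {0..}"
  proof (intro equalityI subsetI)
    fix y assume "y \<in> \<theta>' ` {0..}"
    then obtain s where "0 \<le> s" "y = \<theta>' s" by auto
    moreover have "\<theta>' 0 = 0" using A0 \<theta>0 by (simp add: \<theta>'_def)
    ultimately show "y \<in> {0..}" using \<theta>'_mono[of 0 s] by (cases "s = 0") auto
  next
    fix y :: real assume y: "y \<in> {0..}"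
    consider "y \<le> B" | "B < y" "y \<le> B'" | "B' < y" by linarith
    then show "y \<in> \<theta>' ` {0..}"
    proof cases
      case 1
      have "y \<in> \<theta> ` {0..}" using \<theta>(1) y by (simp add: time_changes_def)
      then obtain s where s: "0 \<le> s" "\<theta> s = y" by auto
      then have "s \<le> A" using mono[of A s] \<theta>A A0 1 by (cases "s \<le> A") auto
      with s show ?thesis by (auto simp: \<theta>'_def intro!: image_eqI[of _ _ s])
    next
      case 2
      define s where "s = A + (y - B) / ((B' - B) / (A' - A))"
      have ls: "l s = y" using less by (simp add: l_def s_def)
      have "A < s" using 2 less by (simp add: s_def)
      moreover have "s \<le> A'" using l_mono[of A' s] lA ls 2 by (cases "s \<le> A'") auto
      ultimately show ?thesis using ls A0 by (auto simp: \<theta>'_def intro!: image_eqI[of _ _ s])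
    next
      case 3
      then show ?thesis using less A0 by (auto simp: \<theta>'_def intro!: image_eqI[of _ _ "y - B' + A'"])
    qed
  qed
  then have "\<theta>' \<in> time_changes" using \<theta>'_mono by (auto simp: time_changes_def strict_mono_on_def)
  moreover have "\<theta>' (a k) = b k" if "k \<le> Suc m" for k
  proof (cases "k = Suc m")
    case True then show ?thesis using lA less by (simp add: \<theta>'_def A'_def B'_def)
  next
    case False
    then have k: "k \<le> m" using that by simp
    have "a k \<le> a m" using k
    proof (induction k rule: inc_induct)
      case (step n) then show ?case using Suc.prems(1)[of n] by simp
    qed simp
    then show ?thesis using \<theta>(2)[OF k] by (simp add: \<theta>'_def A_def)
  qed
  moreover have "\<bar>\<theta>' s - s\<bar> < \<epsilon>" if s: "0 \<le> s" for s
  proof -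
    have ends: "\<bar>B - A\<bar> < \<epsilon>" "\<bar>B' - A'\<bar> < \<epsilon>"
      using Suc.prems(2)[of m] Suc.prems(2)[of "Suc m"] by (auto simp: A_def B_def A'_def B'_def)
    consider "s \<le> A" | "A < s" "s \<le> A'" | "A' < s" by linarith
    then show ?thesis
    proof cases
      case 1 then show ?thesis using \<theta>(3)[OF s] by (simp add: \<theta>'_def)
    next
      case 2
      \<comment> \<open>between two matched times the displacement interpolates its end values\<close>
      define u where "u = (s - A) / (A' - A)"
      have u: "0 \<le> 1 - u" "0 \<le> u" "(1 - u) + u = 1" using 2 less by (auto simp: u_def)
      have s_eq: "s = A + u * (A' - A)" using less by (simp add: u_def)
      have "l s = B + u * (B' - B)" by (simp add: l_def u_def)
      then have "l s - s = B + u * (B' - B) - (A + u * (A' - A))" using s_eq by simp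
      then have "l s - s = (1 - u) * (B - A) + u * (B' - A')" by (simp add: algebra_simps)
      moreover have "(1 - u) * (B - A) + u * (B' - A') < \<epsilon>" "(1 - u) * (A - B) + u * (A' - B') < \<epsilon>"
        using ends u by (intro convex_bound_lt; simp)+
      ultimately show ?thesis using 2 by (simp add: \<theta>'_def abs_less_iff algebra_simps)
    next
      case 3 then show ?thesis using ends less by (simp add: \<theta>'_def)
    qed
  qed
  moreover have "\<theta>' s = s + (B' - A')" if "A' \<le> s" for s
    using that less lA by (cases "s = A'") (auto simp: \<theta>'_def)
  ultimately show ?case unfolding A'_def B'_def by blast
qed

lemma jump_sequence_history:
  assumes "h \<in> histories" shows "jump_sequence (\<lambda>n. fst (h n))"
  unfolding jump_sequence_def
proof (intro conjI allI impI)
  show "fst (h 0) = 0" using assms by (simp add: histories_def)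
  fix n
  show "fst (h n) \<le> fst (h (Suc n))" using assms by (cases n) (auto simp: histories_def)
  show "fst (h n) < \<infinity> \<Longrightarrow> fst (h n) < fst (h (Suc n))" using assms by (cases n) (auto simp: histories_def)
qed

lemma path_of_hist_cadlag:
  assumes "h \<in> nonexplosive_histories" shows "path_of_hist h \<in> cadlag"
  unfolding path_of_hist_def
  by (rule step_path_cadlag[OF jump_sequence_history]) (use assms in \<open>simp_all add: nonexplosive_histories_def\<close>)

text \<open>If two histories are close, then so are their jump times and marks up to any given index. The time
  change that matches the jump times up to the end of the window \<open>[0, 1/\<epsilon>]\<close> turns one path into the
  other up to the small differences between the marks.\<close>

lemma path_of_hist_continuous:
  assumes h: "h \<in> nonexplosive_histories" and \<epsilon>: "0 < \<epsilon>"
  shows "\<exists>r>0. \<forall>h'\<in>nonexplosive_histories. hist_dist h h' < r \<longrightarrow>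
    path_of_hist h' \<in> skorokhod_nbhd (path_of_hist h) \<epsilon>"
proof -
  have hH: "h \<in> histories" and lim: "(\<lambda>n. fst (h n)) \<longlonglongrightarrow> \<infinity>"
    using h by (auto simp: nonexplosive_histories_def)
  define \<tau> where "\<tau> n = fst (h n)" for n
  have js: "jump_sequence \<tau>" using jump_sequence_history[OF hH] unfolding \<tau>_def .
  have lim\<tau>: "\<tau> \<longlonglongrightarrow> \<infinity>" using lim unfolding \<tau>_def .
  obtain n where "ennreal (1/\<epsilon>) < \<tau> n" by (rule nonexplosiveD[OF js lim\<tau>])
  then obtain m where m: "\<tau> m \<le> ennreal (1/\<epsilon>)" "ennreal (1/\<epsilon>) < \<tau> (Suc m)"
    using jump_sequence_interval_exists[OF js] by blast
  have fin: "\<tau> k < \<infinity>" if "k \<le> m" for k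
    using jump_sequence_mono[OF js that] m(1) by (metis ennreal_less_top infinity_ennreal_def order_le_less_trans)
  \<comment> \<open>The matched jump times move by less than half the distance from \<open>1/\<epsilon>\<close> to the next jump, which
    therefore stays outside the time window on which the two paths are compared.\<close>
  define \<gamma> where "\<gamma> = (if \<tau> (Suc m) < \<infinity> then enn2real (\<tau> (Suc m)) - 1/\<epsilon> else 1)"
  have \<gamma>: "0 < \<gamma>"
    using m(2) \<epsilon> by (cases "\<tau> (Suc m)") (auto simp: \<gamma>_def ennreal_less_iff)
  define \<eta> where "\<eta> = min \<epsilon> (\<gamma> / 2)"
  have \<eta>: "0 < \<eta>" "\<eta> \<le> \<epsilon>" "2 * \<eta> \<le> \<gamma>" using \<epsilon> \<gamma> by (auto simp: \<eta>_def)
  define r where "r = (1/2::real) ^ (Suc m + 2) * (\<eta> / (1 + \<eta>))"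
  have "0 < r" using \<eta>(1) by (simp add: r_def)
  moreover have "path_of_hist h' \<in> skorokhod_nbhd (path_of_hist h) \<epsilon>"
    if h': "h' \<in> nonexplosive_histories" and near: "hist_dist h h' < r" for h'
  proof -
    have hH': "h' \<in> histories" using h' by (simp add: nonexplosive_histories_def)
    define \<tau>' where "\<tau>' n = fst (h' n)" for n
    have js': "jump_sequence \<tau>'" using jump_sequence_history[OF hH'] unfolding \<tau>'_def .
    have len: "hist_length h = hist_length h'"
      using hist_dist_less_imp_close(1)[OF \<eta>(1)] near unfolding r_def by blast
    then have fin_iff: "\<tau>' n < \<infinity> \<longleftrightarrow> \<tau> n < \<infinity>" for n
      using hist_length_ge_iff[OF hH] hist_length_ge_iff[OF hH'] by (metis \<tau>_def \<tau>'_def)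
    define a b where "a n = enn2real (\<tau> n)" and "b n = enn2real (\<tau>' n)" for n
    have a: "ennreal (a n) = \<tau> n" and b: "ennreal (b n) = \<tau>' n" if "\<tau> n < \<infinity>" for n
      using that fin_iff[of n] by (auto simp: a_def b_def less_top)
    have ab0: "0 \<le> a n" "0 \<le> b n" for n by (auto simp: a_def b_def)
    have close: "\<bar>a n - b n\<bar> < \<eta>" "dist (the (snd (h n))) (the (snd (h' n))) < \<eta>"
      if "n \<le> Suc m" "\<tau> n < \<infinity>" for n
      using hist_dist_less_imp_close(2)[OF \<eta>(1) near[unfolded r_def] that(1)]
        hist_length_ge_iff[OF hH, of n] that(2)
      by (auto simp: a_def b_def \<tau>_def \<tau>'_def)
    have "\<exists>\<theta>\<in>time_changes. (\<forall>k\<le>m. \<theta> (a k) = b k) \<and> (\<forall>s\<ge>0. \<bar>\<theta> s - s\<bar> < \<eta>) \<and>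
        (\<forall>s\<ge>a m. \<theta> s = s + (b m - a m))"
    proof (rule time_change_exists)
      show "a 0 = 0" "b 0 = 0" using js js' by (auto simp: a_def b_def jump_sequence_def)
      show "\<bar>b k - a k\<bar> < \<eta>" if "k \<le> m" for k
        using close(1)[of k] fin[OF that] that by (simp add: abs_minus_commute)
      show "a k < a (Suc k) \<and> b k < b (Suc k)" if "k < m" for k
      proof -
        have f: "\<tau> k < \<infinity>" "\<tau> (Suc k) < \<infinity>" using fin that by auto
        then have "ennreal (a k) < ennreal (a (Suc k))" "ennreal (b k) < ennreal (b (Suc k))"
          using jump_sequence_less[OF js, of k "Suc k"] jump_sequence_less[OF js', of k "Suc k"] fin_iff
          by (auto simp: a b)
        then show ?thesis using ab0 by (simp add: ennreal_less_iff)
      qed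
    qed
    then obtain \<theta> where \<theta>: "\<theta> \<in> time_changes" "\<And>k. k \<le> m \<Longrightarrow> \<theta> (a k) = b k"
      "\<And>s. 0 \<le> s \<Longrightarrow> \<bar>\<theta> s - s\<bar> < \<eta>" "\<And>s. a m \<le> s \<Longrightarrow> \<theta> s = s + (b m - a m)" by blast
    have mono: "\<theta> s < \<theta> t" if "0 \<le> s" "s < t" for s t
      using \<theta>(1) that by (auto simp: time_changes_def strict_mono_on_def)
    have \<theta>_nonneg: "0 \<le> \<theta> s" if "0 \<le> s" for s
      using \<theta>(1) that unfolding time_changes_def by (auto simp: set_eq_iff image_iff)
    have "dist (path_of_hist h' (\<theta> s)) (path_of_hist h s) < \<epsilon>" if s: "0 \<le> s" "s \<le> 1/\<epsilon>" for s
    proof -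
      have "ennreal s < \<tau> (Suc m)" using m(2) s(2) by (meson ennreal_leI order_le_less_trans)
      then obtain k where k: "k \<le> m" "\<tau> k \<le> ennreal s" "ennreal s < \<tau> (Suc k)"
        using jump_sequence_interval_exists[OF js] by (metis less_Suc_eq_le)
      have fk: "\<tau> k < \<infinity>" using fin k(1) by blast
      have ak: "a k \<le> s" using k(2) a[OF fk] s(1) by (metis ennreal_le_iff)
      have "b k \<le> \<theta> s" using mono[OF ab0(1), of k s] ak \<theta>(2)[OF k(1)] by (cases "a k = s") auto
      then have lower: "\<tau>' k \<le> ennreal (\<theta> s)" using b[OF fk] by (metis ennreal_leI)
      have upper: "ennreal (\<theta> s) < \<tau>' (Suc k)"
      proof (cases "\<tau> (Suc k) < \<infinity>")
        case True
        have sa: "s < a (Suc k)" using k(3) a[OF True] s(1) by (metis ennreal_less_iff)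
        have "\<theta> s < b (Suc k)"
        proof (cases "k = m")
          case False
          then show ?thesis using mono[OF s(1) sa] \<theta>(2)[of "Suc k"] k(1) by simp
        next
          case eq: True
          have "\<theta> s = s + (b m - a m)" using \<theta>(4) ak eq by simp
          also have "\<dots> < 1/\<epsilon> + \<eta>" using s(2) close(1)[of m] fk eq by simp
          also have "\<dots> \<le> a (Suc m) - \<eta>" using \<eta>(3) True eq by (simp add: \<gamma>_def a_def)
          also have "\<dots> < b (Suc m)" using close(1)[of "Suc m"] True eq by simp
          finally show ?thesis using eq by simp
        qed
        then show ?thesis using b[OF True] \<theta>_nonneg[OF s(1)] by (metis ennreal_less_iff)
      next
        case False
        then have "\<tau>' (Suc k) = \<infinity>" using fin_iff[of "Suc k"] by (metis infinity_ennreal_def less_top)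
        then show ?thesis by simp
      qed
      have "path_of_hist h s = the (snd (h k))"
        unfolding path_of_hist_def \<tau>_def[symmetric] by (rule step_path_eq[OF js s(1) k(2,3)])
      moreover have "path_of_hist h' (\<theta> s) = the (snd (h' k))"
        unfolding path_of_hist_def \<tau>'_def[symmetric]
        by (rule step_path_eq[OF js' \<theta>_nonneg[OF s(1)] lower upper])
      ultimately show ?thesis using close(2)[of k] k(1) fk \<eta>(2) by (simp add: dist_commute)
    qed
    moreover have "path_of_hist h' \<in> cadlag" by (rule path_of_hist_cadlag[OF h'])
    ultimately show ?thesis
      unfolding skorokhod_nbhd_def using \<theta>(1,3) \<eta>(2) by (force intro!: bexI[of _ \<theta>])
  qed
  ultimately show ?thesis by blast
qed

lemma openin_hist_topology_time_greater:
  "openin (Metric_space.mtopology histories hist_dist) {h \<in> histories. of_nat K < fst (h n)}"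
  unfolding openin_hist_topology
proof (intro conjI ballI)
  fix h :: "'e::metric_space hist" assume h: "h \<in> {h \<in> histories. of_nat K < fst (h n)}"
  define \<eta> where "\<eta> = (if fst (h n) < \<infinity> then enn2real (fst (h n)) - real K else 1)"
  have \<eta>: "0 < \<eta>"
    using h by (cases "fst (h n)") (auto simp: \<eta>_def ennreal_of_nat_eq_real_of_nat ennreal_less_iff)
  define r where "r = (1/2::real) ^ (n + 2) * (\<eta> / (1 + \<eta>))"
  have "0 < r" using \<eta> by (simp add: r_def)
  moreover have "of_nat K < fst (h' n)" if h': "h' \<in> histories" "hist_dist h h' < r" for h'
  proof -
    note close = hist_dist_less_imp_close[OF \<eta> h'(2)[unfolded r_def]]
    have fin_iff: "fst (h' n) < \<infinity> \<longleftrightarrow> fst (h n) < \<infinity>"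
      using close(1) hist_length_ge_iff[of h n] hist_length_ge_iff[OF h'(1), of n] h by simp
    show ?thesis
    proof (cases "fst (h n) < \<infinity>")
      case True
      then have "\<bar>enn2real (fst (h n)) - enn2real (fst (h' n))\<bar> < \<eta>"
        using close(2)[of n] hist_length_ge_iff[of h n] h by simp
      then have "real K < enn2real (fst (h' n))" using True by (simp add: \<eta>_def)
      then show ?thesis
        using fin_iff True by (cases "fst (h' n)") (auto simp: ennreal_of_nat_eq_real_of_nat ennreal_less_iff)
    next
      case False
      then have "fst (h' n) = \<infinity>" using fin_iff by (metis infinity_ennreal_def less_top)
      then show ?thesis by (simp add: of_nat_less_top)
    qed
  qed
  ultimately show "\<exists>r>0. \<forall>h'\<in>histories. hist_dist h h' < r \<longrightarrow> h' \<in> {h \<in> histories. of_nat K < fst (h n)}"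
    by blast
qed auto

lemma sets_nonexplosive_histories:
  "(nonexplosive_histories :: 'e::metric_space hist set) \<in> sets hist_space"
proof -
  have "nonexplosive_histories = {h :: 'e hist. h \<in> histories \<and> (\<forall>K::nat. \<exists>n. of_nat K < fst (h n))}"
    unfolding nonexplosive_histories_def
    by (intro Collect_cong conj_cong refl nonexplosive_iff jump_sequence_incseq jump_sequence_history)
  also have "\<dots> = (\<Inter>K::nat. \<Union>n. {h :: 'e hist. h \<in> histories \<and> of_nat K < fst (h n)})"
    by auto
  also have "\<dots> \<in> sets hist_space"
    by (intro sets.countable_INT' image_subsetI sets.countable_UN'' sets_borel_of_topology_open
        openin_hist_topology_time_greater) auto
  finally show ?thesis .
qed

lemma measurable_path_of_hist:
  "path_of_hist \<in> restrict_space hist_space nonexplosive_histories \<rightarrow>\<^sub>M (path_space :: (real \<Rightarrow> 'e::metric_space) measure)"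
proof (rule measurable_borel_of_topologyI)
  show "path_of_hist h \<in> topspace skorokhod_topology"
    if "h \<in> space (restrict_space hist_space nonexplosive_histories)" for h :: "'e hist"
    using that path_of_hist_cadlag[of h] by (simp add: space_restrict_space)
next
  fix U :: "(real \<Rightarrow> 'e) set" assume U: "openin skorokhod_topology U"
  define \<B> where "\<B> = {(h, r). 0 < r \<and> (\<forall>h'\<in>nonexplosive_histories. hist_dist h h' < r \<longrightarrow> path_of_hist h' \<in> U)}"
  define V where "V = (\<Union>(h, r)\<in>\<B>. Metric_space.mball histories hist_dist h r)"
  have near: "\<exists>r. (h, r) \<in> \<B>" if h: "h \<in> nonexplosive_histories" "path_of_hist h \<in> U" for h
  proof -
    obtain \<epsilon> where "0 < \<epsilon>" "skorokhod_nbhd (path_of_hist h) \<epsilon> \<subseteq> U"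
      using U h(2) unfolding openin_skorokhod_topology by blast
    then show ?thesis using path_of_hist_continuous[OF h(1)] unfolding \<B>_def by blast
  qed
  have "path_of_hist h \<in> U \<longleftrightarrow> h \<in> V" if h: "h \<in> nonexplosive_histories" for h
  proof
    assume "path_of_hist h \<in> U"
    with near h obtain r where r: "(h, r) \<in> \<B>" by blast
    have hH: "h \<in> histories" using h by (simp add: nonexplosive_histories_def)
    then have "hist_dist h h = 0" using Metric_space.zero[OF Metric_space_hist_dist] by blast
    then have "h \<in> Metric_space.mball histories hist_dist h r"
      using hH r by (simp add: Metric_space.in_mball[OF Metric_space_hist_dist] \<B>_def)
    with r show "h \<in> V" unfolding V_def by blast
  next
    assume "h \<in> V"
    then obtain h0 r where r: "(h0, r) \<in> \<B>" "h \<in> Metric_space.mball histories hist_dist h0 r"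
      unfolding V_def by blast
    then show "path_of_hist h \<in> U"
      using h by (simp add: Metric_space.in_mball[OF Metric_space_hist_dist] \<B>_def)
  qed
  then have "path_of_hist -` U \<inter> space (restrict_space hist_space nonexplosive_histories) =
      V \<inter> space (restrict_space hist_space nonexplosive_histories)"
    by (auto simp: space_restrict_space)
  moreover have "V \<in> sets hist_space"
    unfolding V_def
    by (intro sets_borel_of_topology_open openin_Union)
      (auto intro: Metric_space.openin_mball[OF Metric_space_hist_dist])
  ultimately show "path_of_hist -` U \<inter> space (restrict_space hist_space nonexplosive_histories)
      \<in> sets (restrict_space hist_space nonexplosive_histories)"
    by (auto simp: sets_restrict_space space_restrict_space nonexplosive_histories_def
        intro!: image_eqI[of _ _ V])
qed


section \<open>Nonexplosion of the signal\<close>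

lemma kernel_total_mass:
  assumes "\<kappa> \<in> N \<rightarrow>\<^sub>M prob_algebra (borel :: 'a::topological_space measure)" "p \<in> space N"
  shows "emeasure (\<kappa> p) UNIV = 1"
  using in_space_prob_algebra[OF measurable_space[OF assms]] by simp

lemma counting_process_mono:
  assumes "counting_process M p" "\<omega> \<in> space M" "0 \<le> s" "s \<le> t"
  shows "p s \<omega> \<le> p t \<omega>"
proof -
  have "mono_on {0..} (\<lambda>t. p t \<omega>)" using assms(1,2) unfolding counting_process_def by blast
  then show ?thesis by (rule mono_onD) (use assms(3,4) in auto)
qed

lemma emeasure_stieltjes_Ioc:
  assumes p: "counting_process M p" and \<omega>: "\<omega> \<in> space M" and u: "0 \<le> u"
  shows "emeasure (stieltjes p \<omega>) {0<..u} = ennreal (real (p u \<omega>))"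
proof -
  define G where "G t = real (p (max 0 t) \<omega>)" for t
  have p0: "p 0 \<omega> = 0" and right: "\<And>t. 0 \<le> t \<Longrightarrow> \<forall>\<^sub>F s in at_right t. p s \<omega> = p t \<omega>"
    using p \<omega> by (auto simp: counting_process_def)
  have G_mono: "G x \<le> G y" if "x \<le> y" for x y
    unfolding G_def using that by (intro of_nat_mono counting_process_mono[OF p \<omega>]) auto
  have G_right: "continuous (at_right a) G" for a
  proof -
    have "\<forall>\<^sub>F s in at_right a. G s = G a"
    proof (cases "0 \<le> a")
      case True
      show ?thesis
        using right[OF True] eventually_at_right_less[of a]
        by eventually_elim (use True in \<open>simp add: G_def max_def\<close>)
    next
      case False
      then have "\<forall>\<^sub>F s in at_right a. s < 0" by (intro eventually_at_rightI[of a 0]) auto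
      then show ?thesis by eventually_elim (use False in \<open>simp add: G_def max_def\<close>)
    qed
    then show ?thesis unfolding continuous_within by (rule tendsto_eventually)
  qed
  have "emeasure (interval_measure G) {0<..u} = ennreal (G u - G 0)"
    using u by (intro emeasure_interval_measure_Ioc G_mono G_right)
  then show ?thesis using u p0 unfolding stieltjes_def G_def[abs_def] by simp
qed

context jump_filtering_model
begin

lemma jump_sequence_T: "\<omega> \<in> space M \<Longrightarrow> jump_sequence (\<lambda>k. T k \<omega>)"
  unfolding jump_sequence_def using T_0 T_mono T_strict by auto

lemma T_le_sets:
  assumes "0 \<le> t" shows "{\<omega> \<in> space M. T k \<omega> \<le> ennreal t} \<in> sets (F t)"
proof -
  interpret filtration "space M" "ext_filtration M F" using filtration by (simp add: usual_filtration_def)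
  have F: "ext_filtration M F (ennreal t) = F t" using assms by (simp add: ext_filtration_def)
  have "space (F t) = space M" using space_F[of "ennreal t"] F by simp
  then show ?thesis
    using stopping_timeD[OF T_stopping, of k "ennreal t"] F by (simp add: Measurable.pred_def)
qed

lemma F_subset_M: "0 \<le> t \<Longrightarrow> sets (F t) \<subseteq> sets M" and space_M_in_F: "0 \<le> t \<Longrightarrow> space M \<in> sets (F t)"
proof -
  interpret filtration "space M" "ext_filtration M F" using filtration by (simp add: usual_filtration_def)
  assume "0 \<le> t"
  then have F: "ext_filtration M F (ennreal t) = F t" by (simp add: ext_filtration_def)
  have "ext_filtration M F \<infinity> = M" by (simp add: ext_filtration_def)
  then show "sets (F t) \<subseteq> sets M" using sets_F_mono[of "ennreal t" \<infinity>] F by simp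
  show "space M \<in> sets (F t)" using space_F[of "ennreal t"] F sets.top[of "F t"] by simp
qed

text \<open>The stochastic interval \<open>[0, t \<and> T\<^sub>k]\<close>.\<close>

definition upto_jump :: "nat \<Rightarrow> real \<Rightarrow> ('w \<times> real) set" where
  "upto_jump k t = {(\<omega>, s). \<omega> \<in> space M \<and> 0 \<le> s \<and> s \<le> t \<and> ennreal s \<le> T k \<omega>}"

text \<open>\<open>T\<^sub>k < s\<close> means that \<open>T\<^sub>k \<le> q < s\<close> for some rational \<open>q\<close>, and \<open>{T\<^sub>k \<le> q} \<times> (q,t]\<close> is one of the
  rectangles that generate the predictable sets.\<close>

lemma upto_jump_predictable:
  assumes t: "0 \<le> t" shows "upto_jump k t \<in> sets (predictable_sigma M F)"
proof -
  let ?G = "{A \<times> {0} | A. A \<in> sets (F 0)} \<union> {A \<times> {s<..t} | A s t. 0 \<le> s \<and> s \<le> t \<and> A \<in> sets (F s)}"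
  have "?G \<subseteq> Pow (space M \<times> {0..})"
    using F_subset_M sets.sets_into_space[of _ M] by fastforce
  then have sets: "sets (predictable_sigma M F) = sigma_sets (space M \<times> {0..}) ?G"
    unfolding predictable_sigma_def by simp
  have zero: "A \<times> {0} \<in> sets (predictable_sigma M F)" if "A \<in> sets (F 0)" for A
    unfolding sets using that by (intro sigma_sets.Basic) blast
  have int: "A \<times> {s<..r} \<in> sets (predictable_sigma M F)" if "0 \<le> s" "A \<in> sets (F s)" for A s r
  proof (cases "s \<le> r")
    case True
    then show ?thesis unfolding sets using that by (intro sigma_sets.Basic) blast
  qed simp
  have "upto_jump k t = (space M \<times> {0} \<union> space M \<times> {0<..t}) -
      (\<Union>q\<in>\<rat> \<inter> {0..}. {\<omega> \<in> space M. T k \<omega> \<le> ennreal q} \<times> {q<..t})"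
  proof (intro equalityI subsetI)
    fix p assume p: "p \<in> (space M \<times> {0} \<union> space M \<times> {0<..t}) -
      (\<Union>q\<in>\<rat> \<inter> {0..}. {\<omega> \<in> space M. T k \<omega> \<le> ennreal q} \<times> {q<..t})"
    obtain \<omega> s where ps: "p = (\<omega>, s)" by (cases p)
    have s: "\<omega> \<in> space M" "0 \<le> s" "s \<le> t" using p t by (auto simp: ps)
    have "ennreal s \<le> T k \<omega>"
    proof (rule ccontr)
      assume "\<not> ?thesis"
      then have less: "T k \<omega> < ennreal s" by simp
      then obtain a where a: "T k \<omega> = ennreal a" "0 \<le> a" by (cases "T k \<omega>") auto
      with less have "a < s" by (metis ennreal_less_iff)
      then obtain q where q: "q \<in> \<rat>" "a < q" "q < s" using Rats_dense_in_real by blast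
      then have "T k \<omega> \<le> ennreal q" using a by (simp add: ennreal_leI)
      then show False using p q a(2) s by (auto simp: ps)
    qed
    with s show "p \<in> upto_jump k t" by (simp add: ps upto_jump_def)
  next
    fix p assume "p \<in> upto_jump k t"
    then obtain \<omega> s where ps: "p = (\<omega>, s)" and s: "\<omega> \<in> space M" "0 \<le> s" "s \<le> t" "ennreal s \<le> T k \<omega>"
      by (auto simp: upto_jump_def)
    have "\<not> T k \<omega> \<le> ennreal q" if "0 \<le> q" "q < s" for q
      using s(4) that by (meson ennreal_less_iff leD order_trans)
    with s show "p \<in> (space M \<times> {0} \<union> space M \<times> {0<..t}) -
      (\<Union>q\<in>\<rat> \<inter> {0..}. {\<omega> \<in> space M. T k \<omega> \<le> ennreal q} \<times> {q<..t})"
      by (auto simp: ps)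
  qed
  also have "\<dots> \<in> sets (predictable_sigma M F)"
    by (intro sets.Diff sets.Un zero int sets.countable_UN'' T_le_sets space_M_in_F)
      (auto intro: countable_Int1 countable_rat)
  finally show ?thesis .
qed

text \<open>Up to a jump time the signal has made only finitely many jumps, even if it explodes later.\<close>

lemma pre_stopped_signal_cadlag:
  assumes \<omega>: "\<omega> \<in> space M" and s: "0 < s" "ennreal s \<le> T k \<omega>"
  shows "pre_stopped s (signal T \<zeta> \<omega>) \<in> cadlag"
proof -
  note js = jump_sequence_T[OF \<omega>]
  define m where "m = (LEAST j. ennreal s \<le> T j \<omega>)"
  have m: "ennreal s \<le> T m \<omega>"
    unfolding m_def by (rule LeastI[where P = "\<lambda>j. ennreal s \<le> T j \<omega>", OF s(2)])
  have "m \<noteq> 0" using m s(1) T_0[OF \<omega>] by (cases "m = 0") auto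
  then obtain i where i: "m = Suc i" using not0_implies_Suc by blast
  have "\<not> ennreal s \<le> T i \<omega>" unfolding m_def by (rule not_less_Least) (use i m_def in auto)
  then have "pre_stopped s (signal T \<zeta> \<omega>) = step_path (truncate i (\<lambda>k. T k \<omega>)) (\<lambda>k. \<zeta> k \<omega>)"
    unfolding signal_def using m i by (intro pre_stopped_step_path[OF js]) auto
  then show ?thesis using step_path_cadlag[OF jump_sequence_truncate[OF js] truncate_tendsto] by simp
qed

text \<open>The explicit form of \<open>\<mu>\<close> gives such a bound only up to \<open>T\<^sub>k\<close>: the kernels are probability kernels, and
  \<open>lm\<close> is bounded, at cadlag paths, and after an explosion the signal need not be cadlag. That the
  bound does not depend on \<open>k\<close> is what excludes explosions.\<close>

lemma mu_upto_jump_le: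
  obtains C where "\<And>k t. 0 \<le> t \<Longrightarrow> AE \<omega> in M.
    (\<integral>\<^sup>+(s, z). indicator (upto_jump k t) (\<omega>, s) \<partial>\<mu> \<omega>) \<le> ennreal C * ennreal t + ennreal (real (pm t \<omega>))"
proof -
  obtain C where C: "\<And>t x. 0 < t \<Longrightarrow> x \<in> cadlag \<Longrightarrow> lm (t, x) \<le> C" using lm(2) by blast
  have "AE \<omega> in M. (\<integral>\<^sup>+(s, z). indicator (upto_jump k t) (\<omega>, s) \<partial>\<mu> \<omega>)
      \<le> ennreal C * ennreal t + ennreal (real (pm t \<omega>))" if t: "0 \<le> t" for k t
    using \<mu>_form AE_space
  proof eventually_elim
    case (elim \<omega>)
    note \<omega> = elim(2)
    define u where "u = enn2real (min (ennreal t) (T k \<omega>))"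
    have "min (ennreal t) (T k \<omega>) < \<infinity>" by (simp add: min_less_iff_disj)
    then have u: "ennreal u = min (ennreal t) (T k \<omega>)" by (simp add: u_def less_top)
    have u0: "0 \<le> u" by (simp add: u_def)
    have ut: "u \<le> t" using u t by (metis ennreal_le_iff min.cobounded1)
    have le_u: "s \<le> u \<longleftrightarrow> s \<le> t \<and> ennreal s \<le> T k \<omega>" for s
      using ennreal_le_iff[OF u0, of s] ennreal_le_iff[OF t, of s] u by simp
    let ?x = "\<lambda>s. pre_stopped s (signal T \<zeta> \<omega>)"
    have x: "(s, ?x s) \<in> space (restrict_space borel {0<..} \<Otimes>\<^sub>M path_space)" "?x s \<in> cadlag"
      if "s \<in> {0<..u}" for s
      using pre_stopped_signal_cadlag[OF \<omega>, of s k] that le_u[of s]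
      by (auto simp: space_pair_measure space_restrict_space)
    have sets_mu: "sets (\<mu> \<omega>) = sets (mark_space borel)"
      using \<mu> \<omega> by (simp add: dual_predictable_projection_def)
    have "{0<..u} \<in> sets (restrict_space borel {0<..})"
      by (subst sets_restrict_space_iff) auto
    then have rect: "{0<..u} \<times> UNIV \<in> sets (\<mu> \<omega>)" unfolding sets_mu by (intro pair_measureI) auto
    have "(\<integral>\<^sup>+(s, z). indicator (upto_jump k t) (\<omega>, s) \<partial>\<mu> \<omega>) =
        (\<integral>\<^sup>+p. indicator ({0<..u} \<times> UNIV) p \<partial>\<mu> \<omega>)"
    proof (rule nn_integral_cong)
      fix p assume "p \<in> space (\<mu> \<omega>)"
      then have "0 < fst p"
        using sets_eq_imp_space_eq[OF sets_mu] by (auto simp: space_pair_measure space_restrict_space)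
      then show "(case p of (s, z) \<Rightarrow> indicator (upto_jump k t) (\<omega>, s)) =
          (indicator ({0<..u} \<times> UNIV) p :: ennreal)"
        using \<omega> le_u by (cases p) (auto simp: upto_jump_def split: split_indicator)
    qed
    also have "\<dots> = emeasure (\<mu> \<omega>) ({0<..u} \<times> UNIV)" by (rule nn_integral_indicator[OF rect])
    also have "\<dots> = (\<integral>\<^sup>+s\<in>{0<..u}. emeasure (Qm (s, ?x s)) UNIV * ennreal (lm (s, ?x s)) \<partial>lborel)
          + (\<integral>\<^sup>+s\<in>{0<..u}. emeasure (Rm (s, ?x s)) UNIV \<partial>stieltjes pm \<omega>)"
      using elim(1) u0 by (simp add: Let_def)
    also have "\<dots> \<le> (\<integral>\<^sup>+s. ennreal C * indicator {0<..u} s \<partial>lborel)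
        + (\<integral>\<^sup>+s. indicator {0<..u} s \<partial>stieltjes pm \<omega>)"
    proof (intro add_mono nn_integral_mono)
      fix s show "emeasure (Qm (s, ?x s)) UNIV * ennreal (lm (s, ?x s)) * indicator {0<..u} s
          \<le> ennreal C * indicator {0<..u} s"
        using kernel_total_mass[OF kernels_m(1) x(1)] C[of s, OF _ x(2)]
        by (auto split: split_indicator intro: ennreal_leI)
      show "emeasure (Rm (s, ?x s)) UNIV * indicator {0<..u} s \<le> indicator {0<..u} s"
        using kernel_total_mass[OF kernels_m(2) x(1)] by (auto split: split_indicator)
    qed
    also have "\<dots> = ennreal C * ennreal u + emeasure (stieltjes pm \<omega>) {0<..u}"
      using u0 by (simp add: nn_integral_cmult_indicator stieltjes_def)
    also have "\<dots> = ennreal C * ennreal u + ennreal (real (pm u \<omega>))"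
      by (simp add: emeasure_stieltjes_Ioc[OF pm(1) \<omega> u0])
    also have "\<dots> \<le> ennreal C * ennreal t + ennreal (real (pm t \<omega>))"
    proof (intro add_mono mult_left_mono ennreal_leI of_nat_mono ut)
      show "pm u \<omega> \<le> pm t \<omega>" by (rule counting_process_mono[OF pm(1) \<omega> u0 ut])
    qed simp_all
    finally show ?case .
  qed
  then show ?thesis by (rule that)
qed

lemma signal_measure_upto_jump_ge:
  assumes \<omega>: "\<omega> \<in> space M" and explode: "\<And>j. T j \<omega> \<le> ennreal t" and t: "0 \<le> t"
  shows "of_nat k \<le> (\<integral>\<^sup>+(s, z). indicator (upto_jump k t) (\<omega>, s) \<partial>signal_measure T \<zeta> \<omega>)"
proof -
  note js = jump_sequence_T[OF \<omega>]
  let ?J = "{j. 1 \<le> j \<and> T j \<omega> < \<infinity>}"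
  let ?g = "\<lambda>j. (enn2real (T j \<omega>), signal T \<zeta> \<omega> (enn2real (T j \<omega>)))"
  have fin: "T j \<omega> < \<infinity>" for j using explode[of j] order_le_less_trans by fastforce
  have pos: "0 < enn2real (T j \<omega>)" if "1 \<le> j" for j
    using jump_sequence_less[OF js, of 0 j] that fin T_0[OF \<omega>] by (simp add: enn2real_positive_iff)
  have g: "?g \<in> count_space ?J \<rightarrow>\<^sub>M mark_space borel"
    using pos by (auto simp: space_pair_measure space_restrict_space)
  have time: "{s. 0 \<le> s \<and> s \<le> t \<and> ennreal s \<le> T k \<omega>} \<in> sets borel" by measurable
  have "(\<lambda>p. indicator {s. 0 \<le> s \<and> s \<le> t \<and> ennreal s \<le> T k \<omega>} (fst p) :: ennreal)
      \<in> borel_measurable (mark_space (borel :: 'e measure))"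
  proof (rule measurable_compose[OF _ borel_measurable_indicator[OF time]])
    show "fst \<in> mark_space (borel :: 'e measure) \<rightarrow>\<^sub>M borel"
      by (rule measurable_compose[OF measurable_fst measurable_restrict_space1[OF measurable_ident_sets]]) simp
  qed
  also have "(\<lambda>p. indicator {s. 0 \<le> s \<and> s \<le> t \<and> ennreal s \<le> T k \<omega>} (fst p) :: ennreal) =
      (\<lambda>(s, z). indicator (upto_jump k t) (\<omega>, s))"
    using \<omega> by (auto simp: upto_jump_def fun_eq_iff split: split_indicator)
  finally have V: "(\<lambda>(s, z). indicator (upto_jump k t) (\<omega>, s) :: ennreal)
      \<in> borel_measurable (mark_space (borel :: 'e measure))" .
  have "of_nat k = emeasure (count_space ?J) {1..k}"
    using fin by (subst emeasure_count_space_finite) auto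
  also have "\<dots> = (\<integral>\<^sup>+j. indicator {1..k} j \<partial>count_space ?J)"
    using fin by (subst nn_integral_indicator) auto
  also have "\<dots> \<le> (\<integral>\<^sup>+j. (case ?g j of (s, z) \<Rightarrow> indicator (upto_jump k t) (\<omega>, s)) \<partial>count_space ?J)"
  proof (rule nn_integral_mono)
    fix j assume "j \<in> space (count_space ?J)"
    have "(\<omega>, enn2real (T j \<omega>)) \<in> upto_jump k t" if "j \<le> k"
      using \<omega> jump_sequence_mono[OF js that] fin[of j] explode[of j] t
      by (auto simp: upto_jump_def enn2real_leI)
    then show "(indicator {1..k} j :: ennreal) \<le> (case ?g j of (s, z) \<Rightarrow> indicator (upto_jump k t) (\<omega>, s))"
      by (auto split: split_indicator)
  qed
  also have "\<dots> = (\<integral>\<^sup>+(s, z). indicator (upto_jump k t) (\<omega>, s) \<partial>signal_measure T \<zeta> \<omega>)"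
    unfolding signal_measure_def
    by (rule nn_integral_distr[OF g, symmetric]) (simp only: measurable_distr_eq1 V)
  finally show ?thesis .
qed

text \<open>If all \<open>T\<^sub>j\<close> lie below \<open>t\<close>, then there are \<open>k\<close> jumps in \<open>(0, t \<and> T\<^sub>k]\<close>. The expected number of jumps
  there equals the expected \<open>\<mu>\<close>-mass, so \<open>k\<close> times the probability of this event is bounded uniformly
  in \<open>k\<close>.\<close>

lemma explosion_before_null:
  assumes t: "0 \<le> t" shows "AE \<omega> in M. \<not> (\<forall>k. T k \<omega> \<le> ennreal t)"
proof -
  define A where "A = {\<omega> \<in> space M. \<forall>k. T k \<omega> \<le> ennreal t}"
  have "{\<omega> \<in> space M. T k \<omega> \<le> ennreal t} \<in> sets M" for k using T_le_sets[OF t] F_subset_M[OF t] by blast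
  then have A: "A \<in> sets M" unfolding A_def by (rule sets.sets_Collect_countable_All)
  obtain C where C: "\<And>k t. 0 \<le> t \<Longrightarrow> AE \<omega> in M.
    (\<integral>\<^sup>+(s, z). indicator (upto_jump k t) (\<omega>, s) \<partial>\<mu> \<omega>) \<le> ennreal C * ennreal t + ennreal (real (pm t \<omega>))"
    using mu_upto_jump_le by blast
  define B where "B = ennreal C * ennreal t + (\<integral>\<^sup>+\<omega>. ennreal (real (pm t \<omega>)) \<partial>M)"
  have pm_int: "integrable M (\<lambda>\<omega>. real (pm t \<omega>))" by (rule pm(3)[OF t])
  have "B < \<infinity>"
    unfolding B_def using nn_integral_eq_integral[OF pm_int] by (simp add: ennreal_mult_less_top)
  have le: "of_nat k * emeasure M A \<le> B" for k
  proof -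
    have V: "(\<lambda>q. indicator (upto_jump k t) (fst q) :: ennreal) \<in> borel_measurable (predictable_sigma M F \<Otimes>\<^sub>M (borel :: 'e measure))"
      using upto_jump_predictable[OF t] by measurable
    have "of_nat k * emeasure M A = (\<integral>\<^sup>+\<omega>. of_nat k * indicator A \<omega> \<partial>M)"
      using A by (simp add: nn_integral_cmult_indicator)
    also have "\<dots> \<le> (\<integral>\<^sup>+\<omega>. (\<integral>\<^sup>+(s, z). indicator (upto_jump k t) (\<omega>, s) \<partial>signal_measure T \<zeta> \<omega>) \<partial>M)"
      by (intro nn_integral_mono)
        (use signal_measure_upto_jump_ge[OF _ _ t, of _ k] in \<open>auto simp: A_def split: split_indicator\<close>)
    also have "\<dots> = (\<integral>\<^sup>+\<omega>. (\<integral>\<^sup>+(s, z). indicator (upto_jump k t) (\<omega>, s) \<partial>\<mu> \<omega>) \<partial>M)"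
      using \<mu> V unfolding dual_predictable_projection_def by fastforce
    also have "\<dots> \<le> (\<integral>\<^sup>+\<omega>. ennreal C * ennreal t + ennreal (real (pm t \<omega>)) \<partial>M)"
      by (rule nn_integral_mono_AE[OF C[OF t]])
    also have "\<dots> = B"
      unfolding B_def using pm_int by (subst nn_integral_add) (auto simp: emeasure_space_1)
    finally show ?thesis .
  qed
  have "emeasure M A = 0"
  proof (rule ccontr)
    assume "emeasure M A \<noteq> 0"
    then have pos: "0 < measure M A" by (simp add: emeasure_eq_measure measure_nonneg less_le)
    obtain b' where b': "B = ennreal b'" "0 \<le> b'" using \<open>B < \<infinity>\<close> by (cases B) auto
    obtain k :: nat where "b' < real k * measure M A" using reals_Archimedean3[OF pos] by blast
    moreover have "ennreal (real k * measure M A) \<le> ennreal b'"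
      using le[of k] b' by (simp add: emeasure_eq_measure ennreal_mult ennreal_of_nat_eq_real_of_nat)
    ultimately show False using b'(2) by simp
  qed
  then have "A \<in> null_sets M" using A by (simp add: null_sets_def)
  then have "AE \<omega> in M. \<omega> \<notin> A" by (rule AE_not_in)
  then show ?thesis using AE_space by eventually_elim (simp add: A_def)
qed

lemma nonexplosive: "AE \<omega> in M. (\<lambda>k. T k \<omega>) \<longlonglongrightarrow> \<infinity>"
proof -
  have "AE \<omega> in M. \<forall>K::nat. \<not> (\<forall>k. T k \<omega> \<le> ennreal (real K))"
    by (subst AE_all_countable) (intro allI explosion_before_null of_nat_0_le_iff)
  then show ?thesis
    using AE_space
  proof eventually_elim
    case (elim \<omega>)
    then show ?case
      unfolding nonexplosive_iff[OF jump_sequence_incseq[OF jump_sequence_T[OF elim(2)]]]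
      by (simp add: not_le ennreal_of_nat_eq_real_of_nat)
  qed
qed

end


section \<open>Equality of the filters\<close>

lemma path_of_hist_of_step:
  assumes "jump_sequence \<tau>" "\<tau> \<longlonglongrightarrow> \<infinity>"
  shows "path_of_hist (\<lambda>k. (\<tau> k, if \<tau> k < \<infinity> then Some (z k) else None)) = step_path \<tau> z"
proof
  fix t
  show "path_of_hist (\<lambda>k. (\<tau> k, if \<tau> k < \<infinity> then Some (z k) else None)) t = step_path \<tau> z t"
  proof (cases "0 \<le> t")
    case True
    obtain N where "ennreal t < \<tau> N" by (rule nonexplosiveD[OF assms])
    then obtain k where k: "\<tau> k \<le> ennreal t" "ennreal t < \<tau> (Suc k)"
      using jump_sequence_interval_exists[OF assms(1)] by blast
    then have "\<tau> k < \<infinity>" using order_le_less_trans[OF k(1), of \<infinity>] by simp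
    then show ?thesis
      unfolding path_of_hist_def fst_conv snd_conv
      using step_path_eq[OF assms(1) True k, of z]
        step_path_eq[OF assms(1) True k, of "\<lambda>k. the (if \<tau> k < \<infinity> then Some (z k) else None)"] by simp
  qed (simp add: path_of_hist_def step_path_def)
qed

text \<open>With \<open>T\<^sub>i \<le> t < T\<^bsub>i+1\<^esub>\<close>, the stopped signal is the step path of the first \<open>i\<close> jumps, and the history
  process lists just these jumps. That it is the history of the stopped path uses that the signal
  changes its value at each jump time.\<close>

lemma (in jump_filtering_model) history_is_history_of_stopped_signal:
  assumes \<omega>: "\<omega> \<in> space M" and lim: "(\<lambda>k. T k \<omega>) \<longlonglongrightarrow> \<infinity>" and t: "0 \<le> t"
  defines "x \<equiv> stopped t (signal T \<zeta> \<omega>)" and "h \<equiv> history_process T \<zeta> t \<omega>"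
  shows "x \<in> pure_jump_paths" "h \<in> nonexplosive_histories" "hist_of_path x = h" "path_of_hist h = x"
proof -
  note js = jump_sequence_T[OF \<omega>]
  obtain N where "ennreal t < T N \<omega>" by (rule nonexplosiveD[OF js lim])
  then obtain i where i: "T i \<omega> \<le> ennreal t" "ennreal t < T (Suc i) \<omega>"
    using jump_sequence_interval_exists[OF js] by blast
  define \<tau> where "\<tau> = truncate i (\<lambda>k. T k \<omega>)"
  define z where "z k = \<zeta> k \<omega>" for k
  have \<tau>: "jump_sequence \<tau>" "\<tau> \<longlonglongrightarrow> \<infinity>"
    unfolding \<tau>_def by (rule jump_sequence_truncate[OF js], rule truncate_tendsto)
  have x: "x = step_path \<tau> z"
    unfolding x_def signal_def \<tau>_def z_def by (rule stopped_step_path[OF js t i])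
  have changes: "z (Suc k) \<noteq> z k" if "\<tau> (Suc k) < \<infinity>" for k
    using that T_jump[OF \<omega>, of k] by (auto simp: \<tau>_def truncate_def z_def split: if_splits)
  have "(THE j. T j \<omega> \<le> ennreal t \<and> ennreal t < T (Suc j) \<omega>) = i"
    using i jump_sequence_interval_unique[OF js] by (intro the_equality) blast+
  then have "h = history_upto T \<zeta> i \<omega>" by (simp add: h_def history_process_def)
  also have "\<dots> = (\<lambda>k. (\<tau> k, if \<tau> k < \<infinity> then Some (z k) else None))"
  proof
    fix k
    show "history_upto T \<zeta> i \<omega> k = (\<tau> k, if \<tau> k < \<infinity> then Some (z k) else None)"
    proof (cases "k \<le> i")
      case True
      then have fin: "T k \<omega> < \<infinity>"
        using order_le_less_trans[OF order_trans[OF jump_sequence_mono[OF js True] i(1)], of \<infinity>] by simp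
      have "signal T \<zeta> \<omega> (enn2real (T k \<omega>)) = z k"
        unfolding signal_def z_def by (rule step_path_at_jump[OF js fin])
      with True fin show ?thesis by (simp add: history_upto_def \<tau>_def truncate_def)
    qed (simp add: history_upto_def \<tau>_def truncate_def)
  qed
  finally have h: "h = (\<lambda>k. (\<tau> k, if \<tau> k < \<infinity> then Some (z k) else None))" .
  show hx: "hist_of_path x = h" unfolding x h by (rule hist_of_step_path[of \<tau> z, OF \<tau>(1) changes])
  show "path_of_hist h = x" unfolding x h by (rule path_of_hist_of_step[OF \<tau>])
  have ct: "change_time x = \<tau>" unfolding x using change_time_step_path[of \<tau> z] \<tau>(1) changes by blast
  show "x \<in> pure_jump_paths"
    unfolding pure_jump_paths_eq using \<tau> ct step_path_cadlag[OF \<tau>] x by simp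
  have "h \<in> histories" using hist_of_path_histories[of x] ct \<tau>(2) hx by simp
  then show "h \<in> nonexplosive_histories" using \<tau>(2) by (simp add: nonexplosive_histories_def h)
qed

text \<open>Over a complete measure almost everywhere equality preserves measurability, also its failure; if
  the integrands are not measurable, both sides have the default value of \<open>nn_cond_exp\<close>. So the
  filters can be compared through the almost sure correspondence of paths and histories alone.\<close>

lemma nn_cond_exp_AE_eq:
  assumes "complete_measure M" and ae: "AE x in M. f x = g x"
  shows "nn_cond_exp M G f = nn_cond_exp M G g"
proof -
  interpret complete_measure M by fact
  have meas: "v \<in> borel_measurable M" if u: "u \<in> borel_measurable M" and uv: "AE x in M. u x = v x"
    for u v :: "'a \<Rightarrow> ennreal"
  proof (rule measurableI)
    fix A :: "ennreal set" assume "A \<in> sets borel"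
    then have A: "u -` A \<inter> space M \<in> sets M" by (rule measurable_sets[OF u])
    have "AE x in M. x \<in> u -` A \<inter> space M \<longleftrightarrow> x \<in> v -` A \<inter> space M"
      using uv by eventually_elim simp
    then show "v -` A \<inter> space M \<in> sets M" by (rule in_sets_AE[OF _ A]) simp
  qed simp
  have ae': "AE x in M. g x = f x" using ae by eventually_elim simp
  show ?thesis
  proof (cases "f \<in> borel_measurable M")
    case True
    then have g: "g \<in> borel_measurable M" using meas ae by blast
    show ?thesis unfolding nn_cond_exp_def using density_cong[OF True g ae] True g by simp
  next
    case False
    then have "g \<notin> borel_measurable M" using meas ae' by blast
    with False show ?thesis unfolding nn_cond_exp_def by simp
  qed
qed

lemma real_cond_exp_AE_eq:
  assumes "complete_measure M" and ae: "AE x in M. f x = g x"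
  shows "real_cond_exp M G f = real_cond_exp M G g"
proof -
  have "AE x in M. ennreal (f x) = ennreal (g x)" "AE x in M. ennreal (- f x) = ennreal (- g x)"
    using ae by (eventually_elim, simp)+
  then show ?thesis
    unfolding real_cond_exp_def using nn_cond_exp_AE_eq[OF assms(1)] by metis
qed

text \<open>Both integrals are versions of the conditional expectation of the same random variable, because
  the two functions correspond to each other under the bijection between paths and histories.\<close>

lemma (in jump_filtering_model) filters_agree:
  fixes \<phi> :: "(real \<Rightarrow> 'e) \<Rightarrow> real" and f :: "'e hist \<Rightarrow> real"
  assumes pi: "filter_process M G path_space (\<lambda>t \<omega>. stopped t (signal T \<zeta> \<omega>)) \<pi>"
    and Pi: "filter_process M G hist_space (history_process T \<zeta>) \<pi>\<^sub>H"
    and \<phi>: "\<phi> \<in> borel_measurable path_space" "bounded (\<phi> ` cadlag)"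
    and f: "f \<in> borel_measurable hist_space" "bounded (f ` histories)"
    and eq: "\<And>x h. x \<in> pure_jump_paths \<Longrightarrow> h \<in> nonexplosive_histories \<Longrightarrow>
      hist_of_path x = h \<Longrightarrow> path_of_hist h = x \<Longrightarrow> f h = \<phi> x"
    and t: "0 \<le> t"
  shows "AE \<omega> in M. (\<integral>h. f h \<partial>\<pi>\<^sub>H t \<omega>) = (\<integral>x. \<phi> x \<partial>\<pi> t \<omega>)"
proof -
  have "AE \<omega> in M. f (history_process T \<zeta> t \<omega>) = \<phi> (stopped t (signal T \<zeta> \<omega>))"
    using nonexplosive AE_space
  proof eventually_elim
    case (elim \<omega>)
    show ?case by (rule eq[OF history_is_history_of_stopped_signal[OF elim(2,1) t]])
  qed
  then have "real_cond_exp M (G t) (\<lambda>\<omega>. f (history_process T \<zeta> t \<omega>)) =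
      real_cond_exp M (G t) (\<lambda>\<omega>. \<phi> (stopped t (signal T \<zeta> \<omega>)))"
    by (rule real_cond_exp_AE_eq[OF complete_measure_axioms])
  moreover have "AE \<omega> in M. (\<integral>h. f h \<partial>\<pi>\<^sub>H t \<omega>) =
      real_cond_exp M (G t) (\<lambda>\<omega>. f (history_process T \<zeta> t \<omega>)) \<omega>"
    using Pi f t by (simp add: filter_process_def)
  moreover have "AE \<omega> in M. (\<integral>x. \<phi> x \<partial>\<pi> t \<omega>) =
      real_cond_exp M (G t) (\<lambda>\<omega>. \<phi> (stopped t (signal T \<zeta> \<omega>))) \<omega>"
    using pi \<phi> t by (simp add: filter_process_def)
  ultimately show ?thesis by auto
qed

theorem lemma4p1:
  fixes M :: "'w measure" and F :: "real \<Rightarrow> 'w measure" and Z :: "'z measure"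
    and T :: "nat \<Rightarrow> 'w \<Rightarrow> ennreal" and \<zeta> :: "nat \<Rightarrow> 'w \<Rightarrow> 'e::polish_space"
    and Y :: "real \<Rightarrow> 'w \<Rightarrow> real"
    and \<pi> :: "real \<Rightarrow> 'w \<Rightarrow> (real \<Rightarrow> 'e) measure"
    and \<pi>\<^sub>H :: "real \<Rightarrow> 'w \<Rightarrow> 'e hist measure"
  assumes model: "jump_filtering_model M F Z T \<zeta> \<mu> W n \<nu> b \<sigma> Ki Kp Gi Gp y\<^sub>0 Y
      Qm Rm lm pm Qn Rn ln' pn"
    and pi: "filter_process M (completed_natural_filtration M Y) path_space
      (\<lambda>t \<omega>. stopped t (signal T \<zeta> \<omega>)) \<pi>"
    and Pi: "filter_process M (completed_natural_filtration M Y) hist_space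
      (history_process T \<zeta>) \<pi>\<^sub>H"
  shows
    "(\<forall>\<phi> :: (real \<Rightarrow> 'e) \<Rightarrow> real.
        \<phi> \<in> borel_measurable path_space \<and> bounded (\<phi> ` cadlag) \<longrightarrow>
        (let f = (\<lambda>h. if h \<in> nonexplosive_histories then \<phi> (path_of_hist h) else 0) in
           bounded (f ` histories) \<and> f \<in> borel_measurable hist_space \<and>
           (\<forall>t\<ge>0. AE \<omega> in M. (\<integral>h. f h \<partial>\<pi>\<^sub>H t \<omega>) = (\<integral>x. \<phi> x \<partial>\<pi> t \<omega>))))
     \<and>
     (\<forall>f :: 'e hist \<Rightarrow> real.
        f \<in> borel_measurable hist_space \<and> bounded (f ` histories) \<longrightarrow>
        (let \<phi> = (\<lambda>x. if x \<in> pure_jump_paths then f (hist_of_path x) else 0) in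
           bounded (\<phi> ` cadlag) \<and> \<phi> \<in> borel_measurable path_space \<and>
           (\<forall>t\<ge>0. AE \<omega> in M. (\<integral>h. f h \<partial>\<pi>\<^sub>H t \<omega>) = (\<integral>x. \<phi> x \<partial>\<pi> t \<omega>))))"
proof (intro conjI allI impI)
  interpret jump_filtering_model M F Z T \<zeta> \<mu> W n \<nu> b \<sigma> Ki Kp Gi Gp y\<^sub>0 Y Qm Rm lm pm Qn Rn ln' pn
    by (rule model)
  {
    fix \<phi> :: "(real \<Rightarrow> 'e) \<Rightarrow> real"
    assume \<phi>: "\<phi> \<in> borel_measurable path_space \<and> bounded (\<phi> ` cadlag)"
    define f where "f h = (if h \<in> nonexplosive_histories then \<phi> (path_of_hist h) else 0)" for h :: "'e hist"
    have "f ` histories \<subseteq> insert 0 (\<phi> ` cadlag)"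
      using path_of_hist_cadlag by (auto simp: f_def)
    then have bdd: "bounded (f ` histories)"
      by (rule bounded_subset[rotated]) (use \<phi> in simp)
    have "nonexplosive_histories \<inter> space hist_space \<in> sets (hist_space :: 'e hist measure)"
      by (intro sets.Int sets_nonexplosive_histories sets.top)
    then have meas: "f \<in> borel_measurable hist_space"
      unfolding f_def[abs_def]
      by (subst measurable_restrict_space_iff[symmetric])
        (use \<phi> in \<open>auto intro: measurable_compose[OF measurable_path_of_hist]\<close>)
    have "AE \<omega> in M. (\<integral>h. f h \<partial>\<pi>\<^sub>H t \<omega>) = (\<integral>x. \<phi> x \<partial>\<pi> t \<omega>)" if "0 \<le> t" for t
      by (rule filters_agree[OF pi Pi _ _ meas bdd _ that]) (use \<phi> in \<open>simp_all add: f_def\<close>)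
    with bdd meas show "let f = (\<lambda>h. if h \<in> nonexplosive_histories then \<phi> (path_of_hist h) else 0) in
        bounded (f ` histories) \<and> f \<in> borel_measurable hist_space \<and>
        (\<forall>t\<ge>0. AE \<omega> in M. (\<integral>h. f h \<partial>\<pi>\<^sub>H t \<omega>) = (\<integral>x. \<phi> x \<partial>\<pi> t \<omega>))"
      unfolding Let_def f_def[abs_def] by blast
  }
  {
    fix f :: "'e hist \<Rightarrow> real"
    assume f: "f \<in> borel_measurable hist_space \<and> bounded (f ` histories)"
    define \<phi> where "\<phi> x = (if x \<in> pure_jump_paths then f (hist_of_path x) else 0)" for x :: "real \<Rightarrow> 'e"
    have "\<phi> ` cadlag \<subseteq> insert 0 (f ` histories)"
      using hist_of_path_histories[OF change_time_tendsto_of_pure_jump] by (auto simp: \<phi>_def)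
    then have bdd: "bounded (\<phi> ` cadlag)"
      by (rule bounded_subset[rotated]) (use f in simp)
    have "pure_jump_paths \<inter> space path_space \<in> sets (path_space :: (real \<Rightarrow> 'e) measure)"
      by (intro sets.Int sets_pure_jump_paths sets.top)
    then have meas: "\<phi> \<in> borel_measurable path_space"
      unfolding \<phi>_def[abs_def]
      by (subst measurable_restrict_space_iff[symmetric])
        (use f in \<open>auto intro: measurable_compose[OF measurable_hist_of_path]\<close>)
    have "AE \<omega> in M. (\<integral>h. f h \<partial>\<pi>\<^sub>H t \<omega>) = (\<integral>x. \<phi> x \<partial>\<pi> t \<omega>)" if "0 \<le> t" for t
      by (rule filters_agree[OF pi Pi meas bdd _ _ _ that]) (use f in \<open>simp_all add: \<phi>_def\<close>)
    with bdd meas show "let \<phi> = (\<lambda>x. if x \<in> pure_jump_paths then f (hist_of_path x) else 0) in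
        bounded (\<phi> ` cadlag) \<and> \<phi> \<in> borel_measurable path_space \<and>
        (\<forall>t\<ge>0. AE \<omega> in M. (\<integral>h. f h \<partial>\<pi>\<^sub>H t \<omega>) = (\<integral>x. \<phi> x \<partial>\<pi> t \<omega>))"
      unfolding Let_def \<phi>_def[abs_def] by blast
  }
qed

end
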